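(* Let $(T,\Sigma,\mu)$ be a non-atomic, $\sigma$-finite measure space and $\Phi$ a Musielak--Orlicz function on $T$. Every functional $f=f_{\mathrm c}+f_{\mathrm s}\in(L^\Phi)^*$, with order continuous component $f_{\mathrm c}$ and singular component $f_{\mathrm s}$, satisfies $$\|f\|_0=\|f_{\mathrm c}\|_0+\|f_{\mathrm s}\|_0.$$
   Context: A function $\Phi\colon T\times[0,\infty]\to[0,\infty]$ is a Musielak--Orlicz function if, for $\mu$-a.e. $t\in T$: (i) $\Phi(t,\cdot)$ is convex and lower semi-continuous; (ii) $\Phi(t,0)=\lim_{u\downarrow0}\Phi(t,u)=0$ and $\Phi(t,\infty)=\infty$; and (iii) $\Phi(\cdot,u)$ is measurable for all $u\ge0$. The complementary function is $\Phi^*(t,v)=\sup_{u>0}(uv-\Phi(t,u))$, $v\ge0$; it is again a Musielak--Orlicz function. $L^0$ is the space of real-valued measurable functions on $T$ (equality $\mu$-a.e.), $I_\Phi(u)=\int_T\Phi(t,|u(t)|)\,d\mu$, $L^\Phi=\{u\in L^0: I_\Phi(\lambda u)<\infty\text{ for some }\lambda>0\}$. The Luxemburg norm $\|u\|_\Phi=\inf\{\lambda>0:I_\Phi(u/\lambda)\le1\}$ makes $L^\Phi$ a Banach space, with topological dual $(L^\Phi)^*$. For $f\in(L^\Phi)^*$, $\|f\|_0=\sup_{u\in L^\Phi\setminus\{0\}}|f(u)|/\|u\|_\Phi$. For $v\in L^{\Phi^*}$, $f_v(u)=\int_T uv\,d\mu$. Every $f\in(L^\Phi)^*$ decomposes uniquely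 as $f=f_{\mathrm c}+f_{\mathrm s}$, where $f_{\mathrm c}=f_v$ for some $v\in L^{\Phi^*}$ (order continuous component) and $f_{\mathrm s}$ (singular component) is purely singular, i.e. has zero order continuous component. For a positive functional $f$ and $0\le u\in L^\Phi$, $f_{\mathrm c}(u)=\inf\{\sup_n f(u_n):0\le u_n\uparrow u\}$ and $f_{\mathrm s}(u)=\sup\{\inf_n f(u_n):u\ge u_n\downarrow0\}$; for general $f$ one uses the positive and negative parts. *)

theory Defs
  imports "HOL-Analysis.Analysis"
begin

definition nonatomic :: "'a measure \<Rightarrow> bool" where
  "nonatomic M \<longleftrightarrow>
    (\<forall>A\<in>sets M. 0 < emeasure M A \<longrightarrow>
      (\<exists>B\<in>sets M. B \<subseteq> A \<and> 0 < emeasure M B \<and> emeasure M B < emeasure M A))"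

text \<open>Functions with values in \<open>[0,\<infinity>]\<close> on \<open>[0,\<infinity>]\<close> are modelled on \<^typ>\<open>ennreal\<close>, whose
  product satisfies \<open>0 * \<infinity> = 0\<close>.\<close>

definition convex_ennreal :: "(ennreal \<Rightarrow> ennreal) \<Rightarrow> bool" where
  "convex_ennreal \<phi> \<longleftrightarrow>
    (\<forall>x y a b. a + b = 1 \<longrightarrow> \<phi> (a * x + b * y) \<le> a * \<phi> x + b * \<phi> y)"

definition lower_semicontinuous :: "(ennreal \<Rightarrow> ennreal) \<Rightarrow> bool" where
  "lower_semicontinuous \<phi> \<longleftrightarrow> (\<forall>x. \<phi> x \<le> Liminf (at x) \<phi>)"

definition musielak_orlicz :: "'a measure \<Rightarrow> ('a \<Rightarrow> ennreal \<Rightarrow> ennreal) \<Rightarrow> bool" where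
  "musielak_orlicz M \<Phi> \<longleftrightarrow>
    (AE t in M. convex_ennreal (\<Phi> t) \<and> lower_semicontinuous (\<Phi> t) \<and>
       \<Phi> t 0 = 0 \<and> (\<Phi> t \<longlongrightarrow> 0) (at_right 0) \<and> \<Phi> t \<infinity> = \<infinity>) \<and>
    (\<forall>u. (\<lambda>t. \<Phi> t u) \<in> borel_measurable M)"

text \<open>The supremum ranges over finite \<open>u\<close> because \<open>\<infinity> - \<infinity> = \<infinity>\<close> in \<^typ>\<open>ennreal\<close>.
  Truncation of the difference at \<open>0\<close> is harmless, since \<open>u * v - \<Phi> t u\<close> tends to \<open>0\<close> as
  \<open>u\<close> decreases to \<open>0\<close>, for finite \<open>v\<close>.\<close>

definition complementary :: "('a \<Rightarrow> ennreal \<Rightarrow> ennreal) \<Rightarrow> 'a \<Rightarrow> ennreal \<Rightarrow> ennreal" where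
  "complementary \<Phi> t v = (SUP u\<in>{0<..<\<infinity>}. u * v - \<Phi> t u)"

definition modular :: "'a measure \<Rightarrow> ('a \<Rightarrow> ennreal \<Rightarrow> ennreal) \<Rightarrow> ('a \<Rightarrow> real) \<Rightarrow> ennreal" where
  "modular M \<Phi> u = (\<integral>\<^sup>+t. \<Phi> t (ennreal \<bar>u t\<bar>) \<partial>M)"

text \<open>Elements of the space are functions; functions equal almost everywhere are not identified,
  but all notions below only depend on the class of a function modulo null sets.\<close>

definition mo_space :: "'a measure \<Rightarrow> ('a \<Rightarrow> ennreal \<Rightarrow> ennreal) \<Rightarrow> ('a \<Rightarrow> real) set" where
  "mo_space M \<Phi> =
    {u \<in> borel_measurable M. \<exists>c>0. modular M \<Phi> (\<lambda>t. c * u t) < \<infinity>}"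

definition luxemburg_norm :: "'a measure \<Rightarrow> ('a \<Rightarrow> ennreal \<Rightarrow> ennreal) \<Rightarrow> ('a \<Rightarrow> real) \<Rightarrow> real" where
  "luxemburg_norm M \<Phi> u = Inf {c. 0 < c \<and> modular M \<Phi> (\<lambda>t. u t / c) \<le> 1}"

text \<open>A functional is a map on functions of which only the values on \<^term>\<open>mo_space M \<Phi>\<close> matter.
  Boundedness makes it constant on classes modulo null sets.\<close>

definition mo_dual ::
    "'a measure \<Rightarrow> ('a \<Rightarrow> ennreal \<Rightarrow> ennreal) \<Rightarrow> (('a \<Rightarrow> real) \<Rightarrow> real) set" where
  "mo_dual M \<Phi> =
    {f. (\<forall>u\<in>mo_space M \<Phi>. \<forall>w\<in>mo_space M \<Phi>. \<forall>a b.
          f (\<lambda>t. a * u t + b * w t) = a * f u + b * f w) \<and>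
        (\<exists>C. \<forall>u\<in>mo_space M \<Phi>. \<bar>f u\<bar> \<le> C * luxemburg_norm M \<Phi> u)}"

text \<open>The supremum is taken in \<^typ>\<open>ennreal\<close>, so that it is \<open>0\<close> if the space is trivial.\<close>

definition dual_norm ::
    "'a measure \<Rightarrow> ('a \<Rightarrow> ennreal \<Rightarrow> ennreal) \<Rightarrow> (('a \<Rightarrow> real) \<Rightarrow> real) \<Rightarrow> ennreal" where
  "dual_norm M \<Phi> f =
    (SUP u\<in>{u \<in> mo_space M \<Phi>. \<not> (AE t in M. u t = 0)}.
       ennreal (\<bar>f u\<bar> / luxemburg_norm M \<Phi> u))"

definition cone_ext :: "(('a \<Rightarrow> real) \<Rightarrow> real) \<Rightarrow> ('a \<Rightarrow> real) \<Rightarrow> real" where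
  "cone_ext p u = p (\<lambda>t. max (u t) 0) - p (\<lambda>t. max (- u t) 0)"

definition positive_part ::
    "'a measure \<Rightarrow> ('a \<Rightarrow> ennreal \<Rightarrow> ennreal) \<Rightarrow> (('a \<Rightarrow> real) \<Rightarrow> real) \<Rightarrow> ('a \<Rightarrow> real) \<Rightarrow> real" where
  "positive_part M \<Phi> f =
    cone_ext (\<lambda>u. Sup {f w | w. w \<in> mo_space M \<Phi> \<and> (AE t in M. 0 \<le> w t \<and> w t \<le> u t)})"

definition negative_part ::
    "'a measure \<Rightarrow> ('a \<Rightarrow> ennreal \<Rightarrow> ennreal) \<Rightarrow> (('a \<Rightarrow> real) \<Rightarrow> real) \<Rightarrow> ('a \<Rightarrow> real) \<Rightarrow> real" where
  "negative_part M \<Phi> f = positive_part M \<Phi> (\<lambda>u. - f u)"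

definition increases_to ::
    "'a measure \<Rightarrow> ('a \<Rightarrow> ennreal \<Rightarrow> ennreal) \<Rightarrow> (nat \<Rightarrow> 'a \<Rightarrow> real) \<Rightarrow> ('a \<Rightarrow> real) \<Rightarrow> bool" where
  "increases_to M \<Phi> w u \<longleftrightarrow>
    (\<forall>n. w n \<in> mo_space M \<Phi>) \<and>
    (AE t in M. 0 \<le> w 0 t \<and> incseq (\<lambda>n. w n t) \<and> (\<lambda>n. w n t) \<longlonglongrightarrow> u t)"

text \<open>For a positive functional \<open>p\<close>: \<open>p\<^sub>c u = inf {sup\<^sub>n p (w\<^sub>n) : 0 \<le> w\<^sub>n \<up> u}\<close> on the
  positive cone, extended to the whole space by linearity.\<close>

definition order_continuous_pos ::
    "'a measure \<Rightarrow> ('a \<Rightarrow> ennreal \<Rightarrow> ennreal) \<Rightarrow> (('a \<Rightarrow> real) \<Rightarrow> real) \<Rightarrow> ('a \<Rightarrow> real) \<Rightarrow> real" where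
  "order_continuous_pos M \<Phi> p =
    cone_ext (\<lambda>u. Inf {(SUP n. p (w n)) | w. increases_to M \<Phi> w u})"

definition order_continuous_component ::
    "'a measure \<Rightarrow> ('a \<Rightarrow> ennreal \<Rightarrow> ennreal) \<Rightarrow> (('a \<Rightarrow> real) \<Rightarrow> real) \<Rightarrow> ('a \<Rightarrow> real) \<Rightarrow> real" where
  "order_continuous_component M \<Phi> f u =
    order_continuous_pos M \<Phi> (positive_part M \<Phi> f) u -
    order_continuous_pos M \<Phi> (negative_part M \<Phi> f) u"

definition singular_component ::
    "'a measure \<Rightarrow> ('a \<Rightarrow> ennreal \<Rightarrow> ennreal) \<Rightarrow> (('a \<Rightarrow> real) \<Rightarrow> real) \<Rightarrow> ('a \<Rightarrow> real) \<Rightarrow> real" where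
  "singular_component M \<Phi> f u = f u - order_continuous_component M \<Phi> f u"

definition purely_singular ::
    "'a measure \<Rightarrow> ('a \<Rightarrow> ennreal \<Rightarrow> ennreal) \<Rightarrow> (('a \<Rightarrow> real) \<Rightarrow> real) \<Rightarrow> bool" where
  "purely_singular M \<Phi> g \<longleftrightarrow>
    g \<in> mo_dual M \<Phi> \<and> (\<forall>u\<in>mo_space M \<Phi>. order_continuous_component M \<Phi> g u = 0)"

text \<open>The rest of this theory shows that the components are those of the decomposition in terms of
  the complementary function: whenever \<open>f u = \<integral> u v + g u\<close> with \<open>v\<close> in the complementary space and
  \<open>g\<close> purely singular, the order continuous component of \<open>f\<close> is \<open>u \<mapsto> \<integral> u v\<close> and its singular
  component is \<open>g\<close> (\<open>components_unique\<close>).\<close>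

lemma convex_ennreal_mono:
  assumes c: "convex_ennreal \<phi>" and z: "\<phi> 0 = 0" and i: "\<phi> \<infinity> = \<infinity>" and le: "x \<le> y"
  shows "\<phi> x \<le> \<phi> y"
proof (cases "y = \<infinity> \<or> y = 0")
  case True
  then show ?thesis using z i le by auto
next
  case False
  define a where "a = x / y"
  have "a \<le> 1" using False le unfolding a_def
    by (metis divide_le_posI_ennreal infinity_ennreal_def mult.right_neutral not_gr_zero)
  then have s: "a + (1 - a) = 1" by (simp add: add_diff_inverse_ennreal)
  have "a * y = x" using False unfolding a_def by (simp add: ennreal_divide_times ennreal_mult_divide_eq top.not_eq_extremum)
  then have "\<phi> x \<le> a * \<phi> y"
    using c[unfolded convex_ennreal_def, rule_format, OF s, of y 0] z by simp
  also have "\<dots> \<le> 1 * \<phi> y" using \<open>a \<le> 1\<close> by (intro mult_right_mono) auto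
  finally show ?thesis by simp
qed

lemma convex_ennreal_scale:
  assumes c: "convex_ennreal \<phi>" and z: "\<phi> 0 = 0" and le: "a \<le> 1"
  shows "\<phi> (a * x) \<le> a * \<phi> x"
proof -
  from le have s: "a + (1 - a) = 1" by (simp add: add_diff_inverse_ennreal)
  show ?thesis using c[unfolded convex_ennreal_def, rule_format, OF s, of x 0] z by simp
qed

lemma ennreal_rat_between:
  assumes "a < (b::ennreal)"
  shows "\<exists>q::rat. 0 \<le> q \<and> a \<le> ennreal (of_rat q) \<and> ennreal (of_rat q) < b"
proof -
  obtain r where r: "a < r" "r < b" using assms dense by blast
  obtain a' where a': "a = ennreal a'" "0 \<le> a'" using r by (metis ennreal_cases order.strict_trans top.extremum_strict top.not_eq_extremum)
  obtain r' where r': "r = ennreal r'" "0 \<le> r'" using r by (metis ennreal_cases top.extremum_strict)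
  have "a' < r'" using a' r' r by (simp add: ennreal_less_iff)
  then obtain q where q: "a' < of_rat q" "of_rat q < r'" using of_rat_dense by blast
  then have "0 < (of_rat q :: real)" using a' by linarith
  then have "0 \<le> q" by simp
  moreover have "ennreal (of_rat q) < b"
  proof -
    have "ennreal (of_rat q) \<le> r" unfolding r' by (rule ennreal_leI) (use q in simp)
    then show ?thesis using r(2) by (rule order.strict_trans1)
  qed
  ultimately show ?thesis using q a' by (intro exI[of _ q]) (auto intro: ennreal_leI)
qed

lemma lsc_sup:
  assumes m: "\<And>x y. x \<le> y \<Longrightarrow> \<phi> x \<le> \<phi> y" and l: "lower_semicontinuous \<phi>" and z: "\<phi> 0 = 0"
  shows "\<phi> x = (SUP q::rat. if ennreal (of_rat q) \<le> x then \<phi> (ennreal (of_rat q)) else 0)"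
proof (rule antisym)
  show "(SUP q::rat. if ennreal (of_rat q) \<le> x then \<phi> (ennreal (of_rat q)) else 0) \<le> \<phi> x"
    by (intro SUP_least) (auto intro: m)
  show "\<phi> x \<le> (SUP q::rat. if ennreal (of_rat q) \<le> x then \<phi> (ennreal (of_rat q)) else 0)"
  proof (cases "x = 0")
    case True then show ?thesis by (simp add: z)
  next
    case False
    then have x: "0 < x" by (simp add: zero_less_iff_neq_zero)
    show ?thesis
    proof (rule dense_le)
      fix c assume "c < \<phi> x"
      with l have "eventually (\<lambda>y. c < \<phi> y) (at x)"
        unfolding lower_semicontinuous_def le_Liminf_iff by blast
      then have "eventually (\<lambda>y. c < \<phi> y) (at_left x)"
        by (simp add: eventually_at_split)
      then obtain b where b: "b < x" "\<And>y. b < y \<Longrightarrow> y < x \<Longrightarrow> c < \<phi> y"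
        using x unfolding eventually_at_left[OF x] by auto
      obtain b' where b': "b < b'" "b' < x" using b(1) dense by blast
      obtain q :: rat where q: "b' \<le> ennreal (of_rat q)" "ennreal (of_rat q) < x"
        using ennreal_rat_between[OF b'(2)] by auto
      have "c \<le> \<phi> (ennreal (of_rat q))" using b(2) q b' by (meson less_imp_le order.strict_trans2)
      also have "\<dots> = (if ennreal (of_rat q) \<le> x then \<phi> (ennreal (of_rat q)) else 0)" using q by auto
      also have "\<dots> \<le> (SUP q::rat. if ennreal (of_rat q) \<le> x then \<phi> (ennreal (of_rat q)) else 0)"
        by (rule SUP_upper) simp
      finally show "c \<le> (SUP q::rat. if ennreal (of_rat q) \<le> x then \<phi> (ennreal (of_rat q)) else 0)" .
    qed
  qed
qed

lemma complementary_sup: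
  assumes m: "\<And>x y. x \<le> y \<Longrightarrow> \<Phi> t x \<le> \<Phi> t y" and w: "w < \<infinity>"
  shows "complementary \<Phi> t w = (SUP q::rat. ennreal (of_rat q) * w - \<Phi> t (ennreal (of_rat q)))"
    (is "_ = ?R")
proof (rule antisym)
  show "?R \<le> complementary \<Phi> t w"
  proof (rule SUP_least)
    fix q :: rat
    show "ennreal (of_rat q) * w - \<Phi> t (ennreal (of_rat q)) \<le> complementary \<Phi> t w"
    proof (cases "0 < q")
      case True
      then show ?thesis unfolding complementary_def by (intro SUP_upper) auto
    next
      case False
      then have "ennreal (of_rat q) = 0" by (simp add: ennreal_neg)
      then show ?thesis by simp
    qed
  qed
  show "complementary \<Phi> t w \<le> ?R" unfolding complementary_def
  proof (rule SUP_least)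
    fix x :: ennreal assume x: "x \<in> {0<..<\<infinity>}"
    show "x * w - \<Phi> t x \<le> ?R"
    proof (rule dense_le)
      fix c assume c: "c < x * w - \<Phi> t x"
      have xw: "x * w < top" using x w by (simp add: ennreal_mult_less_top)
      have fin: "\<Phi> t x < \<infinity>" "0 < w"
      proof -
        show "\<Phi> t x < \<infinity>"
        proof (rule ccontr)
          assume "\<not> \<Phi> t x < \<infinity>"
          then have "x * w \<le> \<Phi> t x" by (simp add: less_top[symmetric])
          then have "x * w - \<Phi> t x = 0" by (rule diff_eq_0_ennreal[OF xw])
          with c show False by simp
        qed
        show "0 < w" using c by (cases "w = 0") (auto simp: zero_less_iff_neq_zero)
      qed
      have "c + \<Phi> t x < x * w" using c fin by (simp add: less_diff_eq_ennreal)
      moreover have K: "(c + \<Phi> t x) / w * w = c + \<Phi> t x"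
        using fin w by (simp add: ennreal_divide_times ennreal_mult_divide_eq)
      ultimately have "\<not> x \<le> (c + \<Phi> t x) / w"
        using mult_right_mono[of x "(c + \<Phi> t x) / w" w] by (auto simp: not_le[symmetric])
      then have "(c + \<Phi> t x) / w < x" by simp
      then obtain q :: rat where q: "(c + \<Phi> t x) / w \<le> ennreal (of_rat q)" "ennreal (of_rat q) < x"
        using ennreal_rat_between by blast
      have "c + \<Phi> t x \<le> ennreal (of_rat q) * w"
        using mult_right_mono[OF q(1), of w] K by simp
      moreover have "\<Phi> t (ennreal (of_rat q)) \<le> \<Phi> t x" using q m by auto
      ultimately have "c + \<Phi> t (ennreal (of_rat q)) \<le> ennreal (of_rat q) * w"
        by (meson add_left_mono order_trans)
      moreover have "\<Phi> t (ennreal (of_rat q)) < top"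
        using \<open>\<Phi> t (ennreal (of_rat q)) \<le> \<Phi> t x\<close> fin(1) by auto
      ultimately have "c \<le> ennreal (of_rat q) * w - \<Phi> t (ennreal (of_rat q))"
        using ennreal_minus_mono[of "c + \<Phi> t (ennreal (of_rat q))" _ "\<Phi> t (ennreal (of_rat q))"
            "\<Phi> t (ennreal (of_rat q))"] by (simp add: ennreal_add_diff_cancel_right)
      also have "\<dots> \<le> ?R" by (rule SUP_upper) simp
      finally show "c \<le> ?R" .
    qed
  qed
qed

lemma musielak_orlicz_AE:
  assumes "musielak_orlicz M \<Phi>"
  shows "AE t in M. (\<forall>x y. x \<le> y \<longrightarrow> \<Phi> t x \<le> \<Phi> t y) \<and> (\<forall>a x. a \<le> 1 \<longrightarrow> \<Phi> t (a * x) \<le> a * \<Phi> t x) \<and>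
    lower_semicontinuous (\<Phi> t) \<and> \<Phi> t 0 = 0"
proof -
  have "AE t in M. convex_ennreal (\<Phi> t) \<and> lower_semicontinuous (\<Phi> t) \<and>
       \<Phi> t 0 = 0 \<and> (\<Phi> t \<longlongrightarrow> 0) (at_right 0) \<and> \<Phi> t \<infinity> = \<infinity>"
    using assms unfolding musielak_orlicz_def by blast
  then show ?thesis
    by (rule eventually_mono) (metis convex_ennreal_mono convex_ennreal_scale)
qed

lemma modular_integrand_measurable:
  assumes M: "musielak_orlicz M \<Phi>" and [measurable]: "u \<in> borel_measurable M"
  shows "\<exists>h\<in>borel_measurable M. AE t in M. \<Phi> t (ennreal \<bar>u t\<bar>) = h t"
proof
  let ?h = "\<lambda>t. SUP q::rat. if ennreal (of_rat q) \<le> ennreal \<bar>u t\<bar> then \<Phi> t (ennreal (of_rat q)) else 0"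
  have [measurable]: "\<And>q. (\<lambda>t. \<Phi> t q) \<in> borel_measurable M"
    using M by (simp add: musielak_orlicz_def)
  show "?h \<in> borel_measurable M" by measurable
  show "AE t in M. \<Phi> t (ennreal \<bar>u t\<bar>) = ?h t"
    using musielak_orlicz_AE[OF M] by (rule eventually_mono) (rule lsc_sup, auto)
qed

lemma complementary_integrand_measurable:
  assumes M: "musielak_orlicz M \<Phi>" and [measurable]: "u \<in> borel_measurable M"
  shows "\<exists>h\<in>borel_measurable M. AE t in M. complementary \<Phi> t (ennreal \<bar>u t\<bar>) = h t"
proof
  let ?h = "\<lambda>t. SUP q::rat. ennreal (of_rat q) * ennreal \<bar>u t\<bar> - \<Phi> t (ennreal (of_rat q))"
  have [measurable]: "\<And>q. (\<lambda>t. \<Phi> t q) \<in> borel_measurable M"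
    using M by (simp add: musielak_orlicz_def)
  show "?h \<in> borel_measurable M" by measurable
  show "AE t in M. complementary \<Phi> t (ennreal \<bar>u t\<bar>) = ?h t"
    using musielak_orlicz_AE[OF M] by (rule eventually_mono) (rule complementary_sup, auto)
qed

lemma modular_mono:
  assumes "musielak_orlicz M \<Phi>" and "AE t in M. \<bar>w t\<bar> \<le> \<bar>u t\<bar>"
  shows "modular M \<Phi> w \<le> modular M \<Phi> u"
  unfolding modular_def
  by (rule nn_integral_mono_AE, use musielak_orlicz_AE[OF assms(1)] assms(2) in eventually_elim)
     (auto intro!: ennreal_leI)

lemma mo_space_solid:
  assumes "musielak_orlicz M \<Phi>" and u: "u \<in> mo_space M \<Phi>"
    and "w \<in> borel_measurable M" "AE t in M. \<bar>w t\<bar> \<le> \<bar>u t\<bar>"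
  shows "w \<in> mo_space M \<Phi>"
proof -
  obtain c where c: "c > 0" "modular M \<Phi> (\<lambda>t. c * u t) < \<infinity>"
    using u by (auto simp: mo_space_def)
  have "modular M \<Phi> (\<lambda>t. c * w t) \<le> modular M \<Phi> (\<lambda>t. c * u t)"
    by (rule modular_mono[OF assms(1)]) (use assms(4) c in \<open>auto simp: abs_mult elim!: eventually_mono\<close>)
  with c assms(3) show ?thesis by (auto simp: mo_space_def intro: le_less_trans)
qed

lemma modular_le_1_ex:
  assumes M: "musielak_orlicz M \<Phi>" and u: "u \<in> mo_space M \<Phi>"
  shows "\<exists>c>0. modular M \<Phi> (\<lambda>t. u t / c) \<le> 1"
proof -
  obtain c where c: "c > 0" "modular M \<Phi> (\<lambda>t. c * u t) < \<infinity>" and [measurable]: "u \<in> borel_measurable M"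
    using u by (auto simp: mo_space_def)
  obtain r where r: "modular M \<Phi> (\<lambda>t. c * u t) = ennreal r" "0 \<le> r"
    using c by (cases "modular M \<Phi> (\<lambda>t. c * u t)") auto
  define a where "a = 1 / (1 + r)"
  have a: "0 < a" "a \<le> 1" "a * r \<le> 1" using r by (auto simp: a_def field_simps)
  obtain h where [measurable]: "h \<in> borel_measurable M" and h: "AE t in M. \<Phi> t (ennreal \<bar>c * u t\<bar>) = h t"
    using modular_integrand_measurable[OF M, of "\<lambda>t. c * u t"] by auto
  have "modular M \<Phi> (\<lambda>t. a * (c * u t)) \<le> (\<integral>\<^sup>+t. ennreal a * h t \<partial>M)"
    unfolding modular_def
  proof (rule nn_integral_mono_AE, use musielak_orlicz_AE[OF M] h in eventually_elim)
    case (elim t)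
    have "ennreal \<bar>a * (c * u t)\<bar> = ennreal a * ennreal \<bar>c * u t\<bar>"
      using a by (simp add: ennreal_mult[symmetric] abs_mult)
    moreover have "ennreal a \<le> 1" using a by simp
    ultimately show ?case using elim by metis
  qed
  also have "\<dots> = ennreal a * ennreal r"
    using h r(1) by (simp add: nn_integral_cmult modular_def cong: nn_integral_cong_AE)
  also have "\<dots> \<le> 1" using a r by (simp add: ennreal_mult[symmetric])
  finally show ?thesis using a c
    by (intro exI[of _ "1 / (a * c)"]) (auto simp: field_simps)
qed

lemma luxemburg_norm_mono:
  assumes M: "musielak_orlicz M \<Phi>" and u: "u \<in> mo_space M \<Phi>" and "AE t in M. \<bar>w t\<bar> \<le> \<bar>u t\<bar>"
  shows "luxemburg_norm M \<Phi> w \<le> luxemburg_norm M \<Phi> u"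
  unfolding luxemburg_norm_def
proof (rule cInf_superset_mono)
  show "{c. 0 < c \<and> modular M \<Phi> (\<lambda>t. u t / c) \<le> 1} \<noteq> {}" using modular_le_1_ex[OF M u] by auto
  show "bdd_below {c. 0 < c \<and> modular M \<Phi> (\<lambda>t. w t / c) \<le> 1}" by (rule bdd_belowI[of _ 0]) auto
  show "{c. 0 < c \<and> modular M \<Phi> (\<lambda>t. u t / c) \<le> 1} \<subseteq> {c. 0 < c \<and> modular M \<Phi> (\<lambda>t. w t / c) \<le> 1}"
  proof safe
    fix c :: real assume c: "0 < c" "modular M \<Phi> (\<lambda>t. u t / c) \<le> 1"
    have "modular M \<Phi> (\<lambda>t. w t / c) \<le> modular M \<Phi> (\<lambda>t. u t / c)"
      by (rule modular_mono[OF M])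
        (use assms(3) c in \<open>auto simp: divide_right_mono elim!: eventually_mono\<close>)
    with c show "modular M \<Phi> (\<lambda>t. w t / c) \<le> 1" by simp
  qed
qed

lemma luxemburg_norm_nonneg:
  assumes M: "musielak_orlicz M \<Phi>" and u: "u \<in> mo_space M \<Phi>"
  shows "0 \<le> luxemburg_norm M \<Phi> u"
  unfolding luxemburg_norm_def using modular_le_1_ex[OF M u] by (intro cInf_greatest) auto

lemma integrable_complementary_mult:
  assumes M: "musielak_orlicz M \<Phi>" and u: "u \<in> mo_space M \<Phi>" and v: "v \<in> mo_space M (complementary \<Phi>)"
  shows "integrable M (\<lambda>t. u t * v t)"
proof -
  obtain c where c: "c > 0" "modular M \<Phi> (\<lambda>t. c * u t) < \<infinity>" and [measurable]: "u \<in> borel_measurable M"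
    using u by (auto simp: mo_space_def)
  obtain d where d: "d > 0" "modular M (complementary \<Phi>) (\<lambda>t. d * v t) < \<infinity>" and [measurable]: "v \<in> borel_measurable M"
    using v by (auto simp: mo_space_def)
  obtain h where [measurable]: "h \<in> borel_measurable M" and h: "AE t in M. \<Phi> t (ennreal \<bar>c * u t\<bar>) = h t"
    using modular_integrand_measurable[OF M, of "\<lambda>t. c * u t"] by auto
  obtain k where [measurable]: "k \<in> borel_measurable M"
      and k: "AE t in M. complementary \<Phi> t (ennreal \<bar>d * v t\<bar>) = k t"
    using complementary_integrand_measurable[OF M, of "\<lambda>t. d * v t"] by auto
  have "(\<integral>\<^sup>+t. ennreal (norm ((c * u t) * (d * v t))) \<partial>M) \<le> (\<integral>\<^sup>+t. h t + k t \<partial>M)"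
  proof (rule nn_integral_mono_AE, use musielak_orlicz_AE[OF M] h k in eventually_elim)
    case (elim t)
    show ?case
    proof (cases "c * u t = 0")
      case False
      then have "ennreal \<bar>c * u t\<bar> * ennreal \<bar>d * v t\<bar> - \<Phi> t (ennreal \<bar>c * u t\<bar>)
          \<le> complementary \<Phi> t (ennreal \<bar>d * v t\<bar>)"
        unfolding complementary_def by (intro SUP_upper) auto
      then have "ennreal \<bar>c * u t\<bar> * ennreal \<bar>d * v t\<bar> - h t \<le> k t" using elim by simp
      then have "ennreal \<bar>c * u t\<bar> * ennreal \<bar>d * v t\<bar> \<le> h t + k t"
        by (simp add: ennreal_minus_le_iff)
      moreover have "ennreal (norm ((c * u t) * (d * v t))) = ennreal \<bar>c * u t\<bar> * ennreal \<bar>d * v t\<bar>"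
        by (simp add: ennreal_mult[symmetric] abs_mult)
      ultimately show ?thesis by metis
    qed auto
  qed
  also have "\<dots> = (\<integral>\<^sup>+t. h t \<partial>M) + (\<integral>\<^sup>+t. k t \<partial>M)" by (rule nn_integral_add) auto
  also have "\<dots> = modular M \<Phi> (\<lambda>t. c * u t) + modular M (complementary \<Phi>) (\<lambda>t. d * v t)"
    unfolding modular_def using h k by (simp cong: nn_integral_cong_AE)
  also have "\<dots> < \<infinity>" using c d by simp
  finally have "integrable M (\<lambda>t. (c * u t) * (d * v t))"
    by (intro integrableI_bounded) auto
  then have "integrable M (\<lambda>t. (1 / (c * d)) * ((c * u t) * (d * v t)))" by (rule integrable_mult_right)
  then show ?thesis using c d by (simp add: field_simps)
qed

definition order_bounded ::
    "'a measure \<Rightarrow> ('a \<Rightarrow> ennreal \<Rightarrow> ennreal) \<Rightarrow> (('a \<Rightarrow> real) \<Rightarrow> real) \<Rightarrow> bool" where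
  "order_bounded M \<Phi> f \<longleftrightarrow>
    (\<forall>u\<in>mo_space M \<Phi>. \<forall>w\<in>mo_space M \<Phi>. \<forall>a b.
       f (\<lambda>t. a * u t + b * w t) = a * f u + b * f w) \<and>
    (\<forall>u\<in>mo_space M \<Phi>. \<exists>C. \<forall>w\<in>mo_space M \<Phi>. (AE t in M. \<bar>w t\<bar> \<le> \<bar>u t\<bar>) \<longrightarrow> \<bar>f w\<bar> \<le> C)"

lemma order_bounded_dual:
  assumes M: "musielak_orlicz M \<Phi>" and f: "f \<in> mo_dual M \<Phi>"
  shows "order_bounded M \<Phi> f"
proof -
  obtain C where C: "\<And>u. u \<in> mo_space M \<Phi> \<Longrightarrow> \<bar>f u\<bar> \<le> C * luxemburg_norm M \<Phi> u"
    using f unfolding mo_dual_def by blast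
  have "\<bar>f w\<bar> \<le> \<bar>C\<bar> * luxemburg_norm M \<Phi> u"
    if "u \<in> mo_space M \<Phi>" "w \<in> mo_space M \<Phi>" "AE t in M. \<bar>w t\<bar> \<le> \<bar>u t\<bar>" for u w
  proof -
    have "\<bar>f w\<bar> \<le> \<bar>C\<bar> * luxemburg_norm M \<Phi> w"
      using C[OF that(2)] luxemburg_norm_nonneg[OF M that(2)]
      by (meson abs_ge_self mult_right_mono order_trans)
    also have "\<dots> \<le> \<bar>C\<bar> * luxemburg_norm M \<Phi> u"
      using luxemburg_norm_mono[OF M that(1,3)] by (simp add: mult_left_mono)
    finally show ?thesis .
  qed
  then show ?thesis using f unfolding order_bounded_def mo_dual_def by blast
qed

lemma order_bounded_integral:
  assumes M: "musielak_orlicz M \<Phi>" and v: "v \<in> mo_space M (complementary \<Phi>)"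
  shows "order_bounded M \<Phi> (\<lambda>u. \<integral>t. u t * v t \<partial>M)"
  unfolding order_bounded_def
proof (intro conjI ballI allI)
  note i = integrable_complementary_mult[OF M _ v]
  fix u assume u: "u \<in> mo_space M \<Phi>"
  show "(\<integral>t. (a * u t + b * w t) * v t \<partial>M) = a * (\<integral>t. u t * v t \<partial>M) + b * (\<integral>t. w t * v t \<partial>M)"
    if w: "w \<in> mo_space M \<Phi>" for w a b
  proof -
    have "(\<integral>t. (a * u t + b * w t) * v t \<partial>M) = (\<integral>t. a * (u t * v t) + b * (w t * v t) \<partial>M)"
      by (simp add: algebra_simps)
    then show ?thesis using i[OF u] i[OF w] by simp
  qed
  show "\<exists>C. \<forall>w\<in>mo_space M \<Phi>. (AE t in M. \<bar>w t\<bar> \<le> \<bar>u t\<bar>) \<longrightarrow> \<bar>\<integral>t. w t * v t \<partial>M\<bar> \<le> C"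
  proof (intro exI ballI impI)
    fix w assume w: "w \<in> mo_space M \<Phi>" "AE t in M. \<bar>w t\<bar> \<le> \<bar>u t\<bar>"
    have "\<bar>\<integral>t. w t * v t \<partial>M\<bar> \<le> (\<integral>t. \<bar>w t * v t\<bar> \<partial>M)" by (rule integral_abs_bound)
    also have "\<dots> \<le> (\<integral>t. \<bar>u t * v t\<bar> \<partial>M)"
    proof (rule integral_mono_AE)
      show "integrable M (\<lambda>t. \<bar>w t * v t\<bar>)" "integrable M (\<lambda>t. \<bar>u t * v t\<bar>)"
        by (intro integrable_abs i u w(1))+
      show "AE t in M. \<bar>w t * v t\<bar> \<le> \<bar>u t * v t\<bar>"
        using w(2) by eventually_elim (simp add: abs_mult mult_right_mono)
    qed
    finally show "\<bar>\<integral>t. w t * v t \<partial>M\<bar> \<le> (\<integral>t. \<bar>u t * v t\<bar> \<partial>M)" .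
  qed
qed

lemma order_bounded_null:
  assumes f: "order_bounded M \<Phi> f" and w: "w \<in> mo_space M \<Phi>" "AE t in M. w t = 0"
    and M: "musielak_orlicz M \<Phi>"
  shows "f w = 0"
proof (rule ccontr)
  assume n: "f w \<noteq> 0"
  obtain C where C: "\<And>x. x \<in> mo_space M \<Phi> \<Longrightarrow> (AE t in M. \<bar>x t\<bar> \<le> \<bar>w t\<bar>) \<Longrightarrow> \<bar>f x\<bar> \<le> C"
    using f w unfolding order_bounded_def by blast
  obtain a :: nat where a: "real a * \<bar>f w\<bar> > C" using n reals_Archimedean3[of "\<bar>f w\<bar>"] by auto
  have [measurable]: "w \<in> borel_measurable M" using w by (simp add: mo_space_def)
  have ae: "AE t in M. \<bar>real a * w t + 0 * w t\<bar> \<le> \<bar>w t\<bar>" using w(2) by (auto elim!: eventually_mono)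
  have "(\<lambda>t. real a * w t + 0 * w t) \<in> mo_space M \<Phi>"
    by (rule mo_space_solid[OF M w(1) _ ae]) measurable
  from C[OF this ae] have "\<bar>real a * f w + 0 * f w\<bar> \<le> C" using f w unfolding order_bounded_def by metis
  then show False using a by (simp add: abs_mult)
qed

definition cone_sup ::
    "'a measure \<Rightarrow> ('a \<Rightarrow> ennreal \<Rightarrow> ennreal) \<Rightarrow> (('a \<Rightarrow> real) \<Rightarrow> real) \<Rightarrow> ('a \<Rightarrow> real) \<Rightarrow> real" where
  "cone_sup M \<Phi> f u = Sup {f w | w. w \<in> mo_space M \<Phi> \<and> (AE t in M. 0 \<le> w t \<and> w t \<le> u t)}"

definition cone_inf ::
    "'a measure \<Rightarrow> ('a \<Rightarrow> ennreal \<Rightarrow> ennreal) \<Rightarrow> (('a \<Rightarrow> real) \<Rightarrow> real) \<Rightarrow> ('a \<Rightarrow> real) \<Rightarrow> real" where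
  "cone_inf M \<Phi> p u = Inf {(SUP n. p (w n)) | w. increases_to M \<Phi> w u}"

definition pos_cone :: "'a measure \<Rightarrow> ('a \<Rightarrow> ennreal \<Rightarrow> ennreal) \<Rightarrow> ('a \<Rightarrow> real) set" where
  "pos_cone M \<Phi> = {u \<in> mo_space M \<Phi>. AE t in M. 0 \<le> u t}"

definition cone_mono ::
    "'a measure \<Rightarrow> ('a \<Rightarrow> ennreal \<Rightarrow> ennreal) \<Rightarrow> (('a \<Rightarrow> real) \<Rightarrow> real) \<Rightarrow> bool" where
  "cone_mono M \<Phi> p \<longleftrightarrow> (\<forall>u\<in>pos_cone M \<Phi>. 0 \<le> p u) \<and>
    (\<forall>u\<in>pos_cone M \<Phi>. \<forall>w\<in>pos_cone M \<Phi>. (AE t in M. u t \<le> w t) \<longrightarrow> p u \<le> p w)"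

lemma zero_in_pos_cone: "musielak_orlicz M \<Phi> \<Longrightarrow> u \<in> mo_space M \<Phi> \<Longrightarrow> (\<lambda>t. 0) \<in> pos_cone M \<Phi>"
  by (auto simp: pos_cone_def intro: mo_space_solid)

lemma cone_sup_bdd:
  assumes f: "order_bounded M \<Phi> f" and u: "u \<in> pos_cone M \<Phi>"
  shows "bdd_above {f w | w. w \<in> mo_space M \<Phi> \<and> (AE t in M. 0 \<le> w t \<and> w t \<le> u t)}"
proof -
  obtain C where C: "\<And>x. x \<in> mo_space M \<Phi> \<Longrightarrow> (AE t in M. \<bar>x t\<bar> \<le> \<bar>u t\<bar>) \<Longrightarrow> \<bar>f x\<bar> \<le> C"
    using f u unfolding order_bounded_def pos_cone_def by blast
  show ?thesis
  proof (rule bdd_aboveI[of _ C])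
    fix x assume "x \<in> {f w | w. w \<in> mo_space M \<Phi> \<and> (AE t in M. 0 \<le> w t \<and> w t \<le> u t)}"
    then obtain w where w: "x = f w" "w \<in> mo_space M \<Phi>" "AE t in M. 0 \<le> w t \<and> w t \<le> u t" by auto
    have "AE t in M. \<bar>w t\<bar> \<le> \<bar>u t\<bar>" using w(3) by eventually_elim auto
    from C[OF w(2) this] w show "x \<le> C" by simp
  qed
qed

lemma cone_sup_upper:
  assumes "order_bounded M \<Phi> f" "u \<in> pos_cone M \<Phi>" "w \<in> mo_space M \<Phi>" "AE t in M. 0 \<le> w t \<and> w t \<le> u t"
  shows "f w \<le> cone_sup M \<Phi> f u"
  unfolding cone_sup_def by (rule cSup_upper) (use assms cone_sup_bdd in auto)

lemma cone_sup_least: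
  assumes "musielak_orlicz M \<Phi>" "u \<in> pos_cone M \<Phi>"
    "\<And>w. w \<in> mo_space M \<Phi> \<Longrightarrow> AE t in M. 0 \<le> w t \<and> w t \<le> u t \<Longrightarrow> f w \<le> c"
  shows "cone_sup M \<Phi> f u \<le> c"
  unfolding cone_sup_def
proof (rule cSup_least)
  have "(\<lambda>t. 0) \<in> mo_space M \<Phi>" "AE t in M. 0 \<le> (0::real) \<and> 0 \<le> u t"
    using zero_in_pos_cone[OF assms(1)] assms(2) by (auto simp: pos_cone_def)
  then show "{f w | w. w \<in> mo_space M \<Phi> \<and> (AE t in M. 0 \<le> w t \<and> w t \<le> u t)} \<noteq> {}" by blast
qed (use assms(3) in auto)

lemma cone_sup_null:
  assumes M: "musielak_orlicz M \<Phi>" and f: "order_bounded M \<Phi> f"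
    and u: "u \<in> mo_space M \<Phi>" "AE t in M. u t = 0"
  shows "cone_sup M \<Phi> f u = 0"
proof (rule antisym)
  have uc: "u \<in> pos_cone M \<Phi>" using u by (auto simp: pos_cone_def elim!: eventually_mono)
  show "cone_sup M \<Phi> f u \<le> 0"
  proof (rule cone_sup_least[OF M uc])
    fix w assume w: "w \<in> mo_space M \<Phi>" "AE t in M. 0 \<le> w t \<and> w t \<le> u t"
    have "AE t in M. w t = 0" using w(2) u(2) by eventually_elim auto
    then show "f w \<le> 0" using order_bounded_null[OF f w(1) _ M] by simp
  qed
  have "f u \<le> cone_sup M \<Phi> f u"
    by (rule cone_sup_upper[OF f uc u(1)]) (use u(2) in \<open>auto elim!: eventually_mono\<close>)
  then show "0 \<le> cone_sup M \<Phi> f u" using order_bounded_null[OF f u M] by simp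
qed

lemma positive_part_cone:
  assumes M: "musielak_orlicz M \<Phi>" and f: "order_bounded M \<Phi> f" and u: "u \<in> pos_cone M \<Phi>"
  shows "positive_part M \<Phi> f u = cone_sup M \<Phi> f u"
proof -
  have [measurable]: "u \<in> borel_measurable M" using u by (simp add: pos_cone_def mo_space_def)
  have pos: "AE t in M. 0 \<le> u t" using u by (simp add: pos_cone_def)
  have "(\<lambda>t. max (- u t) 0) \<in> mo_space M \<Phi>"
    by (rule mo_space_solid[OF M, of u]) (use u in \<open>auto simp: pos_cone_def\<close>)
  moreover have "AE t in M. max (- u t) 0 = 0" using pos by (auto elim!: eventually_mono)
  ultimately have "cone_sup M \<Phi> f (\<lambda>t. max (- u t) 0) = 0" by (rule cone_sup_null[OF M f])
  moreover have "(AE t in M. 0 \<le> w t \<and> w t \<le> max (u t) 0) \<longleftrightarrow> (AE t in M. 0 \<le> w t \<and> w t \<le> u t)" for w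
    by (rule eventually_subst) (use pos in \<open>auto elim!: eventually_mono\<close>)
  then have "cone_sup M \<Phi> f (\<lambda>t. max (u t) 0) = cone_sup M \<Phi> f u" unfolding cone_sup_def by simp
  ultimately show ?thesis unfolding positive_part_def cone_ext_def cone_sup_def by simp
qed

lemma order_bounded_uminus: "order_bounded M \<Phi> f \<Longrightarrow> order_bounded M \<Phi> (\<lambda>u. - f u)"
  unfolding order_bounded_def by simp

lemma negative_part_cone:
  assumes M: "musielak_orlicz M \<Phi>" and f: "order_bounded M \<Phi> f" and u: "u \<in> pos_cone M \<Phi>"
  shows "negative_part M \<Phi> f u = positive_part M \<Phi> f u - f u"
proof -
  have uN: "u \<in> mo_space M \<Phi>" and pos: "AE t in M. 0 \<le> u t" and [measurable]: "u \<in> borel_measurable M"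
    using u by (auto simp: pos_cone_def mo_space_def)
  have comp: "(\<lambda>t. 1 * u t + (-1) * w t) \<in> mo_space M \<Phi>"
      "AE t in M. 0 \<le> 1 * u t + (-1) * w t \<and> 1 * u t + (-1) * w t \<le> u t"
      "f (\<lambda>t. 1 * u t + (-1) * w t) = f u - f w"
    if w: "w \<in> mo_space M \<Phi>" "AE t in M. 0 \<le> w t \<and> w t \<le> u t" for w
  proof -
    have [measurable]: "w \<in> borel_measurable M" using w by (simp add: mo_space_def)
    show "(\<lambda>t. 1 * u t + (-1) * w t) \<in> mo_space M \<Phi>"
      by (rule mo_space_solid[OF M uN], measurable) (use w(2) in eventually_elim, auto)
    show "AE t in M. 0 \<le> 1 * u t + (-1) * w t \<and> 1 * u t + (-1) * w t \<le> u t"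
      using w(2) by eventually_elim auto
    have "f (\<lambda>t. 1 * u t + (-1) * w t) = 1 * f u + (-1) * f w"
      using f uN w(1) unfolding order_bounded_def by blast
    then show "f (\<lambda>t. 1 * u t + (-1) * w t) = f u - f w" by simp
  qed
  note nf = order_bounded_uminus[OF f]
  have "cone_sup M \<Phi> (\<lambda>u. - f u) u \<le> cone_sup M \<Phi> f u - f u"
  proof (rule cone_sup_least[OF M u])
    fix w assume w: "w \<in> mo_space M \<Phi>" "AE t in M. 0 \<le> w t \<and> w t \<le> u t"
    show "- f w \<le> cone_sup M \<Phi> f u - f u"
      using cone_sup_upper[OF f u comp(1,2)[OF w]] comp(3)[OF w] by linarith
  qed
  moreover have "cone_sup M \<Phi> f u \<le> cone_sup M \<Phi> (\<lambda>u. - f u) u + f u"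
  proof (rule cone_sup_least[OF M u])
    fix w assume w: "w \<in> mo_space M \<Phi>" "AE t in M. 0 \<le> w t \<and> w t \<le> u t"
    show "f w \<le> cone_sup M \<Phi> (\<lambda>u. - f u) u + f u"
      using cone_sup_upper[OF nf u comp(1,2)[OF w]] comp(3)[OF w] by linarith
  qed
  ultimately show ?thesis
    unfolding negative_part_def positive_part_cone[OF M f u] positive_part_cone[OF M nf u] by linarith
qed

lemma cone_mono_positive_part:
  assumes M: "musielak_orlicz M \<Phi>" and f: "order_bounded M \<Phi> f"
  shows "cone_mono M \<Phi> (positive_part M \<Phi> f)"
  unfolding cone_mono_def
proof (intro conjI ballI impI)
  fix u assume u: "u \<in> pos_cone M \<Phi>"
  have z: "(\<lambda>t. 0) \<in> mo_space M \<Phi>" using zero_in_pos_cone[OF M] u by (auto simp: pos_cone_def)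
  have "f (\<lambda>t. 0) \<le> cone_sup M \<Phi> f u"
    by (rule cone_sup_upper[OF f u z]) (use u in \<open>auto simp: pos_cone_def\<close>)
  then show "0 \<le> positive_part M \<Phi> f u"
    using order_bounded_null[OF f z _ M] by (simp add: positive_part_cone[OF M f u])
  fix w assume w: "w \<in> pos_cone M \<Phi>" and le: "AE t in M. u t \<le> w t"
  have "cone_sup M \<Phi> f u \<le> cone_sup M \<Phi> f w"
  proof (rule cone_sup_least[OF M u])
    fix x assume x: "x \<in> mo_space M \<Phi>" "AE t in M. 0 \<le> x t \<and> x t \<le> u t"
    show "f x \<le> cone_sup M \<Phi> f w"
      by (rule cone_sup_upper[OF f w x(1)]) (use x(2) le in eventually_elim, auto)
  qed
  then show "positive_part M \<Phi> f u \<le> positive_part M \<Phi> f w"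
    by (simp add: positive_part_cone[OF M f u] positive_part_cone[OF M f w])
qed

lemma cone_mono_negative_part:
  assumes "musielak_orlicz M \<Phi>" and "order_bounded M \<Phi> f"
  shows "cone_mono M \<Phi> (negative_part M \<Phi> f)"
  unfolding negative_part_def by (intro cone_mono_positive_part order_bounded_uminus assms)

lemma increases_to_cone:
  assumes "increases_to M \<Phi> w u" shows "w n \<in> pos_cone M \<Phi>"
proof -
  have "AE t in M. 0 \<le> w 0 t \<and> incseq (\<lambda>n. w n t)"
    using assms unfolding increases_to_def by (auto elim!: eventually_mono)
  then have "AE t in M. 0 \<le> w n t"
    by (rule eventually_mono) (auto simp: incseq_def intro: order_trans)
  then show ?thesis using assms by (auto simp: pos_cone_def increases_to_def)
qed

lemma increases_to_le:
  assumes "increases_to M \<Phi> w u" shows "AE t in M. w n t \<le> u t"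
proof -
  have "AE t in M. 0 \<le> w 0 t \<and> incseq (\<lambda>n. w n t) \<and> (\<lambda>n. w n t) \<longlonglongrightarrow> u t"
    using assms unfolding increases_to_def by blast
  then show ?thesis by eventually_elim (auto intro: incseq_le)
qed

lemma increases_to_incseq:
  assumes p: "cone_mono M \<Phi> p" and w: "increases_to M \<Phi> w u"
  shows "incseq (\<lambda>n. p (w n))"
proof (rule monoI)
  fix m n :: nat assume "m \<le> n"
  have "AE t in M. incseq (\<lambda>n. w n t)"
    using w unfolding increases_to_def by (auto elim!: eventually_mono)
  then have "AE t in M. w m t \<le> w n t"
    by (rule eventually_mono) (use \<open>m \<le> n\<close> in \<open>auto simp: incseq_def\<close>)
  then show "p (w m) \<le> p (w n)"
    using p increases_to_cone[OF w] unfolding cone_mono_def by blast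
qed

lemma increases_to_tendsto:
  assumes p: "cone_mono M \<Phi> p" and u: "u \<in> pos_cone M \<Phi>" and w: "increases_to M \<Phi> w u"
  shows "(\<lambda>n. p (w n)) \<longlonglongrightarrow> (SUP n. p (w n))"
proof (rule LIMSEQ_incseq_SUP)
  show "incseq (\<lambda>n. p (w n))" by (rule increases_to_incseq[OF p w])
  show "bdd_above (range (\<lambda>n. p (w n)))"
    by (rule bdd_aboveI[of _ "p u"])
      (use p u increases_to_cone[OF w] increases_to_le[OF w] in \<open>auto simp: cone_mono_def\<close>)
qed

lemma increases_to_const: "u \<in> pos_cone M \<Phi> \<Longrightarrow> increases_to M \<Phi> (\<lambda>n. u) u"
  by (auto simp: increases_to_def pos_cone_def incseq_def elim!: eventually_mono)

lemma cone_inf_lower: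
  assumes p: "cone_mono M \<Phi> p" and u: "u \<in> pos_cone M \<Phi>" and w: "increases_to M \<Phi> w u"
  shows "cone_inf M \<Phi> p u \<le> (SUP n. p (w n))"
  unfolding cone_inf_def
proof (rule cInf_lower)
  show "bdd_below {(SUP n. p (w n)) | w. increases_to M \<Phi> w u}"
  proof (rule bdd_belowI[of _ 0])
    fix x assume "x \<in> {(SUP n. p (w n)) | w. increases_to M \<Phi> w u}"
    then obtain y where y: "x = (SUP n. p (y n))" "increases_to M \<Phi> y u" by auto
    show "0 \<le> x" unfolding y(1)
      by (rule LIMSEQ_le_const[OF increases_to_tendsto[OF p u y(2)]])
        (use p increases_to_cone[OF y(2)] in \<open>auto simp: cone_mono_def\<close>)
  qed
qed (use w in auto)

lemma cone_inf_greatest: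
  assumes u: "u \<in> pos_cone M \<Phi>" and "\<And>w. increases_to M \<Phi> w u \<Longrightarrow> c \<le> (SUP n. p (w n))"
  shows "c \<le> cone_inf M \<Phi> p u"
  unfolding cone_inf_def by (rule cInf_greatest) (use assms(2) increases_to_const[OF u] in auto)

lemma cone_inf_add:
  assumes M: "musielak_orlicz M \<Phi>" and p: "cone_mono M \<Phi> p" and q: "cone_mono M \<Phi> q"
    and u: "u \<in> pos_cone M \<Phi>"
  shows "cone_inf M \<Phi> (\<lambda>x. p x + q x) u = cone_inf M \<Phi> p u + cone_inf M \<Phi> q u"
proof (rule antisym)
  have pq: "cone_mono M \<Phi> (\<lambda>x. p x + q x)"
    using p q unfolding cone_mono_def by (auto intro: add_mono)
  have lim: "(SUP n. p (w n) + q (w n)) = (SUP n. p (w n)) + (SUP n. q (w n))"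
    if w: "increases_to M \<Phi> w u" for w
    by (rule LIMSEQ_unique[OF increases_to_tendsto[OF pq u w]
          tendsto_add[OF increases_to_tendsto[OF p u w] increases_to_tendsto[OF q u w]]])
  show "cone_inf M \<Phi> p u + cone_inf M \<Phi> q u \<le> cone_inf M \<Phi> (\<lambda>x. p x + q x) u"
    by (rule cone_inf_greatest[OF u])
      (use lim cone_inf_lower[OF p u] cone_inf_lower[OF q u] in \<open>auto intro: add_mono\<close>)
  have *: "cone_inf M \<Phi> (\<lambda>x. p x + q x) u \<le> (SUP n. p (w n)) + (SUP n. q (z n))"
    if w: "increases_to M \<Phi> w u" and z: "increases_to M \<Phi> z u" for w z
  proof -
    define y where "y n t = min (w n t) (z n t)" for n t
    have wz: "AE t in M. 0 \<le> w 0 t \<and> incseq (\<lambda>n. w n t) \<and> (\<lambda>n. w n t) \<longlonglongrightarrow> u t"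
        "AE t in M. 0 \<le> z 0 t \<and> incseq (\<lambda>n. z n t) \<and> (\<lambda>n. z n t) \<longlonglongrightarrow> u t"
      using w z by (auto simp: increases_to_def)
    have y: "increases_to M \<Phi> y u" unfolding increases_to_def
    proof
      show "\<forall>n. y n \<in> mo_space M \<Phi>"
      proof
        fix n
        have c: "w n \<in> pos_cone M \<Phi>" "z n \<in> pos_cone M \<Phi>" using increases_to_cone w z by blast+
        have [measurable]: "w n \<in> borel_measurable M" "z n \<in> borel_measurable M"
          using c by (auto simp: pos_cone_def mo_space_def)
        have ae: "AE t in M. 0 \<le> w n t" "AE t in M. 0 \<le> z n t" using c by (auto simp: pos_cone_def)
        show "y n \<in> mo_space M \<Phi>"
        proof (rule mo_space_solid[OF M, of "w n"])
          show "w n \<in> mo_space M \<Phi>" using c by (simp add: pos_cone_def)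
          show "y n \<in> borel_measurable M" unfolding y_def by measurable
          show "AE t in M. \<bar>y n t\<bar> \<le> \<bar>w n t\<bar>" using ae by eventually_elim (auto simp: y_def)
        qed
      qed
      show "AE t in M. 0 \<le> y 0 t \<and> incseq (\<lambda>n. y n t) \<and> (\<lambda>n. y n t) \<longlonglongrightarrow> u t"
        using wz
      proof eventually_elim
        case (elim t)
        have "(\<lambda>n. min (w n t) (z n t)) \<longlonglongrightarrow> min (u t) (u t)" using elim by (intro tendsto_min) auto
        moreover have "incseq (\<lambda>n. min (w n t) (z n t))"
          unfolding incseq_def by (intro allI impI min.mono) (use elim in \<open>auto simp: incseq_def\<close>)
        ultimately show ?case using elim by (simp add: y_def)
      qed
    qed
    have pw: "(SUP n. p (y n)) \<le> (SUP n. p (w n))"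
    proof (rule LIMSEQ_le[OF increases_to_tendsto[OF p u y] increases_to_tendsto[OF p u w]])
      show "\<exists>N. \<forall>n\<ge>N. p (y n) \<le> p (w n)"
        using p increases_to_cone[OF y] increases_to_cone[OF w] by (auto simp: cone_mono_def y_def)
    qed
    have qz: "(SUP n. q (y n)) \<le> (SUP n. q (z n))"
    proof (rule LIMSEQ_le[OF increases_to_tendsto[OF q u y] increases_to_tendsto[OF q u z]])
      show "\<exists>N. \<forall>n\<ge>N. q (y n) \<le> q (z n)"
        using q increases_to_cone[OF y] increases_to_cone[OF z] by (auto simp: cone_mono_def y_def)
    qed
    show ?thesis using cone_inf_lower[OF pq u y] lim[OF y] pw qz by linarith
  qed
  have "cone_inf M \<Phi> (\<lambda>x. p x + q x) u - (SUP n. q (z n)) \<le> cone_inf M \<Phi> p u"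
    if "increases_to M \<Phi> z u" for z
    by (rule cone_inf_greatest[OF u]) (use * that in \<open>auto simp: algebra_simps\<close>)
  then have "cone_inf M \<Phi> (\<lambda>x. p x + q x) u - cone_inf M \<Phi> p u \<le> cone_inf M \<Phi> q u"
    by (intro cone_inf_greatest[OF u]) (auto simp: algebra_simps)
  then show "cone_inf M \<Phi> (\<lambda>x. p x + q x) u \<le> cone_inf M \<Phi> p u + cone_inf M \<Phi> q u" by simp
qed

lemma cone_inf_cong:
  assumes "\<And>w. w \<in> pos_cone M \<Phi> \<Longrightarrow> p w = q w"
  shows "cone_inf M \<Phi> p u = cone_inf M \<Phi> q u"
proof -
  have "increases_to M \<Phi> w u \<Longrightarrow> (SUP n. p (w n)) = (SUP n. q (w n))" for w
    using assms[OF increases_to_cone] by (intro SUP_cong) blast+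
  then show ?thesis unfolding cone_inf_def by (metis (mono_tags, lifting))
qed

lemma cone_inf_positive_part:
  assumes M: "musielak_orlicz M \<Phi>" and h: "order_bounded M \<Phi> h" and u: "u \<in> pos_cone M \<Phi>"
    and cont: "\<And>x y. x \<in> mo_space M \<Phi> \<Longrightarrow> (\<And>n. y n \<in> mo_space M \<Phi>) \<Longrightarrow>
      (AE t in M. (\<forall>n. \<bar>y n t\<bar> \<le> \<bar>x t\<bar>) \<and> (\<lambda>n. y n t) \<longlonglongrightarrow> x t) \<Longrightarrow> (\<lambda>n. h (y n)) \<longlonglongrightarrow> h x"
  shows "cone_inf M \<Phi> (positive_part M \<Phi> h) u = positive_part M \<Phi> h u"
proof (rule antisym)
  let ?p = "positive_part M \<Phi> h"
  note p = cone_mono_positive_part[OF M h]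
  show "cone_inf M \<Phi> ?p u \<le> ?p u"
    using cone_inf_lower[OF p u increases_to_const[OF u]] by simp
  show "?p u \<le> cone_inf M \<Phi> ?p u"
  proof (rule cone_inf_greatest[OF u])
    fix w assume w: "increases_to M \<Phi> w u"
    have "cone_sup M \<Phi> h u \<le> (SUP n. ?p (w n))"
    proof (rule cone_sup_least[OF M u])
      fix x assume x: "x \<in> mo_space M \<Phi>" "AE t in M. 0 \<le> x t \<and> x t \<le> u t"
      define y where "y n t = min (x t) (w n t)" for n t
      have [measurable]: "x \<in> borel_measurable M" using x by (simp add: mo_space_def)
      have wm[measurable]: "\<And>n. w n \<in> borel_measurable M"
        using w by (simp add: increases_to_def mo_space_def)
      have pos: "AE t in M. \<forall>n. 0 \<le> w n t"
        using increases_to_cone[OF w] by (simp add: pos_cone_def AE_all_countable)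
      have ae: "AE t in M. \<forall>n. \<bar>y n t\<bar> \<le> \<bar>x t\<bar>"
        using pos x(2) by eventually_elim (auto simp: y_def min_def)
      have y: "y n \<in> mo_space M \<Phi>" for n
      proof (rule mo_space_solid[OF M x(1)])
        show "y n \<in> borel_measurable M" unfolding y_def by measurable
        show "AE t in M. \<bar>y n t\<bar> \<le> \<bar>x t\<bar>" using ae by eventually_elim auto
      qed
      have "AE t in M. (\<lambda>n. w n t) \<longlonglongrightarrow> u t"
        using w unfolding increases_to_def by (auto elim!: eventually_mono)
      then have "AE t in M. (\<lambda>n. y n t) \<longlonglongrightarrow> x t" using x(2)
      proof eventually_elim
        case (elim t)
        have "(\<lambda>n. min (x t) (w n t)) \<longlonglongrightarrow> min (x t) (u t)" using elim by (intro tendsto_min) auto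
        with elim show ?case by (simp add: y_def min_def)
      qed
      with ae have "AE t in M. (\<forall>n. \<bar>y n t\<bar> \<le> \<bar>x t\<bar>) \<and> (\<lambda>n. y n t) \<longlonglongrightarrow> x t" by eventually_elim auto
      then have lim: "(\<lambda>n. h (y n)) \<longlonglongrightarrow> h x" by (rule cont[OF x(1) y])
      have "h (y n) \<le> ?p (w n)" for n
        unfolding positive_part_cone[OF M h increases_to_cone[OF w]]
        by (rule cone_sup_upper[OF h increases_to_cone[OF w] y])
          (use pos x(2) in eventually_elim, auto simp: y_def)
      then show "h x \<le> (SUP n. ?p (w n))"
        by (intro LIMSEQ_le[OF lim increases_to_tendsto[OF p u w]]) auto
    qed
    then show "?p u \<le> (SUP n. ?p (w n))" by (simp add: positive_part_cone[OF M h u])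
  qed
qed

lemma order_continuous_component_eq:
  "order_continuous_component M \<Phi> f u =
    (cone_inf M \<Phi> (positive_part M \<Phi> f) (\<lambda>t. max (u t) 0) - cone_inf M \<Phi> (negative_part M \<Phi> f) (\<lambda>t. max (u t) 0)) -
    (cone_inf M \<Phi> (positive_part M \<Phi> f) (\<lambda>t. max (- u t) 0) - cone_inf M \<Phi> (negative_part M \<Phi> f) (\<lambda>t. max (- u t) 0))"
  unfolding order_continuous_component_def order_continuous_pos_def cone_ext_def cone_inf_def by simp

theorem components_unique:
  assumes M: "musielak_orlicz M \<Phi>" and f: "f \<in> mo_dual M \<Phi>"
    and v: "v \<in> mo_space M (complementary \<Phi>)" and g: "purely_singular M \<Phi> g"
    and eq: "\<And>u. u \<in> mo_space M \<Phi> \<Longrightarrow> f u = (\<integral>t. u t * v t \<partial>M) + g u"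
    and u: "u \<in> mo_space M \<Phi>"
  shows "order_continuous_component M \<Phi> f u = (\<integral>t. u t * v t \<partial>M)"
    and "singular_component M \<Phi> f u = g u"
proof -
  define h where "h u = (\<integral>t. u t * v t \<partial>M)" for u
  have obf: "order_bounded M \<Phi> f" by (rule order_bounded_dual[OF M f])
  have obg: "order_bounded M \<Phi> g" using g by (intro order_bounded_dual[OF M]) (simp add: purely_singular_def)
  have obh: "order_bounded M \<Phi> h" unfolding h_def by (rule order_bounded_integral[OF M v])
  have [measurable]: "v \<in> borel_measurable M" using v by (simp add: mo_space_def)
  have cont: "(\<lambda>n. h (y n)) \<longlonglongrightarrow> h x"
    if x: "x \<in> mo_space M \<Phi>" and y: "\<And>n. y n \<in> mo_space M \<Phi>"
      and ae: "AE t in M. (\<forall>n. \<bar>y n t\<bar> \<le> \<bar>x t\<bar>) \<and> (\<lambda>n. y n t) \<longlonglongrightarrow> x t" for x y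
    unfolding h_def
  proof (rule integral_dominated_convergence)
    have [measurable]: "x \<in> borel_measurable M" "\<And>n. y n \<in> borel_measurable M"
      using x y by (auto simp: mo_space_def)
    show "(\<lambda>t. x t * v t) \<in> borel_measurable M" "\<And>n. (\<lambda>t. y n t * v t) \<in> borel_measurable M" by measurable
    show "integrable M (\<lambda>t. \<bar>x t * v t\<bar>)"
      by (intro integrable_abs integrable_complementary_mult[OF M x v])
    show "AE t in M. (\<lambda>n. y n t * v t) \<longlonglongrightarrow> x t * v t"
      using ae by eventually_elim (auto intro: tendsto_mult_right)
    show "AE t in M. norm (y n t * v t) \<le> \<bar>x t * v t\<bar>" for n
      using ae by eventually_elim (auto simp: abs_mult intro: mult_right_mono)
  qed
  note cm = cone_mono_positive_part[OF M] cone_mono_negative_part[OF M]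
  have key: "cone_inf M \<Phi> (positive_part M \<Phi> f) x - cone_inf M \<Phi> (negative_part M \<Phi> f) x =
      h x + (cone_inf M \<Phi> (positive_part M \<Phi> g) x - cone_inf M \<Phi> (negative_part M \<Phi> g) x)"
    if x: "x \<in> pos_cone M \<Phi>" for x
  proof -
    have hp: "cone_inf M \<Phi> (positive_part M \<Phi> h) x = positive_part M \<Phi> h x"
      by (rule cone_inf_positive_part[OF M obh x cont])
    have hn: "cone_inf M \<Phi> (negative_part M \<Phi> h) x = negative_part M \<Phi> h x"
      unfolding negative_part_def
      by (rule cone_inf_positive_part[OF M order_bounded_uminus[OF obh] x]) (intro tendsto_minus cont)
    have add3: "cone_inf M \<Phi> (\<lambda>x. p x + q x + r x) x =
        cone_inf M \<Phi> p x + cone_inf M \<Phi> q x + cone_inf M \<Phi> r x"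
      if "cone_mono M \<Phi> p" "cone_mono M \<Phi> q" "cone_mono M \<Phi> r" for p q r
    proof -
      have "cone_mono M \<Phi> (\<lambda>x. p x + q x)" using that unfolding cone_mono_def by (auto intro: add_mono)
      then show ?thesis using that by (simp add: cone_inf_add[OF M _ _ x])
    qed
    have "cone_inf M \<Phi> (\<lambda>x. positive_part M \<Phi> f x + negative_part M \<Phi> h x + negative_part M \<Phi> g x) x =
        cone_inf M \<Phi> (\<lambda>x. negative_part M \<Phi> f x + positive_part M \<Phi> h x + positive_part M \<Phi> g x) x"
    proof (rule cone_inf_cong)
      fix w assume w: "w \<in> pos_cone M \<Phi>"
      have "f w = h w + g w" using w eq by (simp add: pos_cone_def h_def)
      then show "positive_part M \<Phi> f w + negative_part M \<Phi> h w + negative_part M \<Phi> g w =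
          negative_part M \<Phi> f w + positive_part M \<Phi> h w + positive_part M \<Phi> g w"
        using negative_part_cone[OF M obf w] negative_part_cone[OF M obg w] negative_part_cone[OF M obh w]
        by linarith
    qed
    then have "cone_inf M \<Phi> (positive_part M \<Phi> f) x + negative_part M \<Phi> h x + cone_inf M \<Phi> (negative_part M \<Phi> g) x =
        cone_inf M \<Phi> (negative_part M \<Phi> f) x + positive_part M \<Phi> h x + cone_inf M \<Phi> (positive_part M \<Phi> g) x"
      using cm[OF obf] cm[OF obg] cm[OF obh] by (simp add: add3 hp hn)
    then show ?thesis using negative_part_cone[OF M obh x] by linarith
  qed
  have [measurable]: "u \<in> borel_measurable M" using u by (simp add: mo_space_def)
  have c: "(\<lambda>t. max (u t) 0) \<in> pos_cone M \<Phi>" "(\<lambda>t. max (- u t) 0) \<in> pos_cone M \<Phi>"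
    unfolding pos_cone_def by (auto intro!: mo_space_solid[OF M u])
  have "h (\<lambda>t. 1 * max (u t) 0 + (-1) * max (- u t) 0) = 1 * h (\<lambda>t. max (u t) 0) + (-1) * h (\<lambda>t. max (- u t) 0)"
    by (rule obh[unfolded order_bounded_def, THEN conjunct1, rule_format])
      (use c in \<open>auto simp: pos_cone_def\<close>)
  moreover have "(\<lambda>t. 1 * max (u t) 0 + (-1) * max (- u t) 0) = u" by (auto simp: max_def)
  ultimately have hu: "h u = h (\<lambda>t. max (u t) 0) - h (\<lambda>t. max (- u t) 0)" by simp
  have "order_continuous_component M \<Phi> g u = 0" using g u by (simp add: purely_singular_def)
  then show 1: "order_continuous_component M \<Phi> f u = (\<integral>t. u t * v t \<partial>M)"
    unfolding order_continuous_component_eq key[OF c(1)] key[OF c(2)] using hu by (simp add: h_def)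
  show "singular_component M \<Phi> f u = g u"
    unfolding singular_component_def 1 using eq[OF u] by simp
qed

end

theory Submission
  imports Defs
begin

text \<open>The singular component lives on sets decreasing to a null set: given \<open>v \<ge> 0\<close> in the space, there
  are \<open>E\<^sub>n \<down> \<emptyset>\<close> such that \<open>\<bar>f\<bar>\<^sub>s\<close> is arbitrarily small on \<open>v\<close> restricted to the complement of
  \<open>E\<^sub>n\<close>, uniformly in \<open>n\<close>, while \<open>\<bar>f\<bar>\<^sub>c\<close> of \<open>v\<close> restricted to \<open>E\<^sub>n\<close> tends to \<open>0\<close>. For \<open>u\<close> and \<open>w\<close> of
  modular at most \<open>1\<close>, the function equal to \<open>u\<close> off \<open>E\<^sub>n\<close> and to \<open>w\<close> on \<open>E\<^sub>n\<close> has modular at most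
  \<open>1 + \<integral>\<^bsub>E\<^sub>n\<^esub> \<Phi>(t, \<bar>w\<bar>) \<rightarrow> 1\<close>, and \<open>f\<close> takes on it nearly the value \<open>f\<^sub>c u + f\<^sub>s w\<close>. All properties of
  the components are read off their definition by infima over increasing sequences, without a
  Radon-Nikodym representation.\<close>

section \<open>The space and its positive cone\<close>

lemma mo_space_measurable: "u \<in> mo_space M \<Phi> \<Longrightarrow> u \<in> borel_measurable M"
  by (simp add: mo_space_def)

text \<open>For small e > 0 one has |e (a u + b w)| <= max |c u| |d w| pointwise. Monotonicity of
  \<Phi> then bounds the integrand by the sum of two with finite integral.\<close>

lemma mo_space_lincomb:
  assumes M: "musielak_orlicz M \<Phi>" and u: "u \<in> mo_space M \<Phi>" and w: "w \<in> mo_space M \<Phi>"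
  shows "(\<lambda>t. a * u t + b * w t) \<in> mo_space M \<Phi>"
proof -
  note [measurable] = mo_space_measurable[OF u] mo_space_measurable[OF w]
  obtain c where c: "c > 0" "modular M \<Phi> (\<lambda>t. c * u t) < \<infinity>"
    using u by (auto simp: mo_space_def)
  obtain d where d: "d > 0" "modular M \<Phi> (\<lambda>t. d * w t) < \<infinity>"
    using w by (auto simp: mo_space_def)
  \<comment> \<open>Measurability of the integrands is known only up to a null set, so
    \<open>h\<close> and \<open>k\<close> replace them before the integral of a sum is
    split.\<close>
  obtain h where [measurable]: "h \<in> borel_measurable M" and h: "AE t in M. \<Phi> t (ennreal \<bar>c * u t\<bar>) = h t"
    using modular_integrand_measurable[OF M, of "\<lambda>t. c * u t"] by auto
  obtain k where [measurable]: "k \<in> borel_measurable M" and k: "AE t in M. \<Phi> t (ennreal \<bar>d * w t\<bar>) = k t"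
    using modular_integrand_measurable[OF M, of "\<lambda>t. d * w t"] by auto
  \<comment> \<open>Each term becomes at most half of |c u| or of |d w|, so that the sum is at most
    the larger of these two. The summand 1 in the denominators covers zero coefficients.\<close>
  define e where "e = min (c / (2 * (1 + \<bar>a\<bar>))) (d / (2 * (1 + \<bar>b\<bar>)))"
  have e: "0 < e" "e * \<bar>a\<bar> \<le> c / 2" "e * \<bar>b\<bar> \<le> d / 2"
  proof -
    show "0 < e" using c d by (simp add: e_def add_pos_nonneg)
    have "e * \<bar>a\<bar> \<le> c / (2 * (1 + \<bar>a\<bar>)) * (1 + \<bar>a\<bar>)"
      by (rule mult_mono) (use c in \<open>auto simp: e_def\<close>)
    also have "\<dots> = c / 2" by (simp add: field_simps add_pos_nonneg)
    finally show "e * \<bar>a\<bar> \<le> c / 2" .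
    have "e * \<bar>b\<bar> \<le> d / (2 * (1 + \<bar>b\<bar>)) * (1 + \<bar>b\<bar>)"
      by (rule mult_mono) (use d in \<open>auto simp: e_def\<close>)
    also have "\<dots> = d / 2" by (simp add: field_simps add_pos_nonneg)
    finally show "e * \<bar>b\<bar> \<le> d / 2" .
  qed
  have "modular M \<Phi> (\<lambda>t. e * (a * u t + b * w t)) \<le> (\<integral>\<^sup>+t. h t + k t \<partial>M)"
    unfolding modular_def
  proof (rule nn_integral_mono_AE, use musielak_orlicz_AE[OF M] h k in eventually_elim)
    case (elim t)
    have "\<bar>e * (a * u t + b * w t)\<bar> \<le> (e * \<bar>a\<bar>) * \<bar>u t\<bar> + (e * \<bar>b\<bar>) * \<bar>w t\<bar>"
      using e(1) abs_triangle_ineq[of "e * (a * u t)" "e * (b * w t)"]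
      by (simp add: abs_mult distrib_left)
    also have "\<dots> \<le> c / 2 * \<bar>u t\<bar> + d / 2 * \<bar>w t\<bar>"
      by (intro add_mono mult_right_mono e) auto
    also have "\<dots> \<le> max \<bar>c * u t\<bar> \<bar>d * w t\<bar>" using c d by (simp add: abs_mult max_def)
    finally consider "\<bar>e * (a * u t + b * w t)\<bar> \<le> \<bar>c * u t\<bar>" | "\<bar>e * (a * u t + b * w t)\<bar> \<le> \<bar>d * w t\<bar>"
      by linarith
    then show ?case
    proof cases
      case 1
      then have "\<Phi> t (ennreal \<bar>e * (a * u t + b * w t)\<bar>) \<le> h t"
        using elim by (metis ennreal_leI)
      then show ?thesis by (rule order_trans) simp
    next
      case 2
      then have "\<Phi> t (ennreal \<bar>e * (a * u t + b * w t)\<bar>) \<le> k t"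
        using elim by (metis ennreal_leI)
      then show ?thesis by (rule order_trans) simp
    qed
  qed
  also have "\<dots> = (\<integral>\<^sup>+t. h t \<partial>M) + (\<integral>\<^sup>+t. k t \<partial>M)" by (rule nn_integral_add) auto
  also have "\<dots> = modular M \<Phi> (\<lambda>t. c * u t) + modular M \<Phi> (\<lambda>t. d * w t)"
    unfolding modular_def using h k by (simp cong: nn_integral_cong_AE)
  also have "\<dots> < \<infinity>" using c d by simp
  finally show ?thesis using e(1) by (auto simp: mo_space_def)
qed

lemma pos_cone_add:
  assumes "musielak_orlicz M \<Phi>" "u \<in> pos_cone M \<Phi>" "w \<in> pos_cone M \<Phi>"
  shows "(\<lambda>t. u t + w t) \<in> pos_cone M \<Phi>"
proof -
  have "AE t in M. 0 \<le> u t" "AE t in M. 0 \<le> w t" using assms by (auto simp: pos_cone_def)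
  then have "AE t in M. 0 \<le> u t + w t" by eventually_elim auto
  then show ?thesis
    using mo_space_lincomb[OF assms(1), of u w 1 1] assms by (simp add: pos_cone_def)
qed

lemma pos_cone_solid:
  assumes "musielak_orlicz M \<Phi>" "u \<in> mo_space M \<Phi>" "w \<in> borel_measurable M"
    "AE t in M. 0 \<le> w t \<and> w t \<le> \<bar>u t\<bar>"
  shows "w \<in> pos_cone M \<Phi>"
proof -
  have "AE t in M. \<bar>w t\<bar> \<le> \<bar>u t\<bar>" using assms(4) by eventually_elim auto
  moreover have "AE t in M. 0 \<le> w t" using assms(4) by eventually_elim auto
  ultimately show ?thesis using mo_space_solid[OF assms(1-3)] by (auto simp: pos_cone_def)
qed

lemma pos_cone_diff:
  assumes "musielak_orlicz M \<Phi>" "u \<in> pos_cone M \<Phi>" "w \<in> pos_cone M \<Phi>" "AE t in M. w t \<le> u t"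
  shows "(\<lambda>t. u t - w t) \<in> pos_cone M \<Phi>"
proof (rule pos_cone_solid[OF assms(1)])
  show "u \<in> mo_space M \<Phi>" using assms(2) by (simp add: pos_cone_def)
  show "(\<lambda>t. u t - w t) \<in> borel_measurable M"
    using assms(2,3) by (auto simp: pos_cone_def mo_space_def)
  have "AE t in M. 0 \<le> w t" using assms(3) by (simp add: pos_cone_def)
  then show "AE t in M. 0 \<le> u t - w t \<and> u t - w t \<le> \<bar>u t\<bar>"
    using assms(4) by eventually_elim auto
qed

lemma pos_cone_sum:
  assumes M: "musielak_orlicz M \<Phi>" and "\<And>j. w j \<in> pos_cone M \<Phi>"
  shows "(\<lambda>t. \<Sum>j\<le>(n::nat). w j t) \<in> pos_cone M \<Phi>"
  by (induction n) (auto intro: assms pos_cone_add)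

lemma pos_cone_parts:
  assumes M: "musielak_orlicz M \<Phi>" and u: "u \<in> mo_space M \<Phi>"
  shows "(\<lambda>t. max (u t) 0) \<in> pos_cone M \<Phi>" "(\<lambda>t. max (- u t) 0) \<in> pos_cone M \<Phi>"
    "(\<lambda>t. \<bar>u t\<bar>) \<in> pos_cone M \<Phi>"
proof -
  note [measurable] = mo_space_measurable[OF u]
  show "(\<lambda>t. max (u t) 0) \<in> pos_cone M \<Phi>" "(\<lambda>t. max (- u t) 0) \<in> pos_cone M \<Phi>"
    "(\<lambda>t. \<bar>u t\<bar>) \<in> pos_cone M \<Phi>"
    by (rule pos_cone_solid[OF M u]; auto)+
qed

section \<open>Additive functionals on the positive cone\<close>

text \<open>Scalar multiples do not occur: the arguments on the cone work with sums and differences,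
  and a factor 2 is written as a sum.\<close>

definition cone_additive ::
    "'a measure \<Rightarrow> ('a \<Rightarrow> ennreal \<Rightarrow> ennreal) \<Rightarrow> (('a \<Rightarrow> real) \<Rightarrow> real) \<Rightarrow> bool" where
  "cone_additive M \<Phi> p \<longleftrightarrow> (\<forall>u\<in>pos_cone M \<Phi>. 0 \<le> p u) \<and>
    (\<forall>u\<in>pos_cone M \<Phi>. \<forall>w\<in>pos_cone M \<Phi>. p (\<lambda>t. u t + w t) = p u + p w)"

lemma cone_additive_add:
  "cone_additive M \<Phi> p \<Longrightarrow> u \<in> pos_cone M \<Phi> \<Longrightarrow> w \<in> pos_cone M \<Phi> \<Longrightarrow>
    p (\<lambda>t. u t + w t) = p u + p w"
  by (simp add: cone_additive_def)

lemma cone_additive_mono: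
  assumes M: "musielak_orlicz M \<Phi>" and p: "cone_additive M \<Phi> p"
  shows "cone_mono M \<Phi> p"
  unfolding cone_mono_def
proof (intro conjI ballI impI)
  fix u w assume u: "u \<in> pos_cone M \<Phi>" and w: "w \<in> pos_cone M \<Phi>" and le: "AE t in M. u t \<le> w t"
  have d: "(\<lambda>t. w t - u t) \<in> pos_cone M \<Phi>" by (rule pos_cone_diff[OF M w u le])
  have "p w = p u + p (\<lambda>t. w t - u t)" using cone_additive_add[OF p u d] by simp
  moreover have "0 \<le> p (\<lambda>t. w t - u t)" using p d by (simp add: cone_additive_def)
  ultimately show "p u \<le> p w" by simp
qed (use p in \<open>simp add: cone_additive_def\<close>)

lemma cone_mono_le:
  "cone_mono M \<Phi> p \<Longrightarrow> u \<in> pos_cone M \<Phi> \<Longrightarrow> w \<in> pos_cone M \<Phi> \<Longrightarrow> AE t in M. u t \<le> w t \<Longrightarrow> p u \<le> p w"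
  by (simp add: cone_mono_def)

lemma cone_additive_sum:
  assumes M: "musielak_orlicz M \<Phi>" and p: "cone_additive M \<Phi> p" and "\<And>j. w j \<in> pos_cone M \<Phi>"
  shows "p (\<lambda>t. \<Sum>j\<le>(n::nat). w j t) = (\<Sum>j\<le>n. p (w j))"
  by (induction n) (auto simp: assms(3) cone_additive_add[OF p pos_cone_sum[OF M]])

lemma cone_additive_plus:
  "cone_additive M \<Phi> p \<Longrightarrow> cone_additive M \<Phi> q \<Longrightarrow> cone_additive M \<Phi> (\<lambda>u. p u + q u)"
  by (simp add: cone_additive_def)

text \<open>The Riesz decomposition property: a function x with 0 <= x <= u + w splits into min x u,
  which lies between 0 and u, and a remainder between 0 and w. This gives subadditivity of the
  supremum; for the converse, competitors for u and w are added.\<close>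

lemma cone_additive_positive_part:
  assumes M: "musielak_orlicz M \<Phi>" and f: "order_bounded M \<Phi> f"
  shows "cone_additive M \<Phi> (positive_part M \<Phi> f)"
  unfolding cone_additive_def
proof (intro conjI ballI)
  fix u assume u: "u \<in> pos_cone M \<Phi>"
  show "0 \<le> positive_part M \<Phi> f u"
    using cone_mono_positive_part[OF M f] u by (simp add: cone_mono_def)
  fix w assume w: "w \<in> pos_cone M \<Phi>"
  have uw: "(\<lambda>t. u t + w t) \<in> pos_cone M \<Phi>" by (rule pos_cone_add[OF M u w])
  have um: "u \<in> mo_space M \<Phi>" "w \<in> mo_space M \<Phi>" "AE t in M. 0 \<le> u t" "AE t in M. 0 \<le> w t"
    using u w by (auto simp: pos_cone_def)
  note [measurable] = mo_space_measurable[OF um(1)] mo_space_measurable[OF um(2)]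
  have lin: "f (\<lambda>t. x t + y t) = f x + f y" if "x \<in> mo_space M \<Phi>" "y \<in> mo_space M \<Phi>" for x y
  proof -
    have "f (\<lambda>t. a * x t + b * y t) = a * f x + b * f y" for a b
      using f that unfolding order_bounded_def by blast
    from this[of 1 1] show ?thesis by simp
  qed
  have "cone_sup M \<Phi> f (\<lambda>t. u t + w t) \<le> cone_sup M \<Phi> f u + cone_sup M \<Phi> f w"
  proof (rule cone_sup_least[OF M uw])
    fix x assume x: "x \<in> mo_space M \<Phi>" "AE t in M. 0 \<le> x t \<and> x t \<le> u t + w t"
    note [measurable] = mo_space_measurable[OF x(1)]
    define y where "y t = min (x t) (u t)" for t
    define z where "z t = x t - y t" for t
    have ae: "AE t in M. 0 \<le> y t \<and> y t \<le> u t" "AE t in M. 0 \<le> z t \<and> z t \<le> w t"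
      using x(2) um(3,4) by (eventually_elim, auto simp: y_def z_def)+
    have yz: "y \<in> mo_space M \<Phi>" "z \<in> mo_space M \<Phi>"
    proof -
      show "y \<in> mo_space M \<Phi>" 
        by (rule mo_space_solid[OF M um(1)])
          (unfold y_def, measurable, use ae(1) in eventually_elim, auto simp: y_def)
      show "z \<in> mo_space M \<Phi>" 
        by (rule mo_space_solid[OF M um(2)])
          (unfold z_def y_def, measurable, use ae(2) in eventually_elim, auto simp: y_def z_def)
    qed
    have "x = (\<lambda>t. y t + z t)" by (simp add: z_def)
    then have "f x = f y + f z" using lin[OF yz] by simp
    then show "f x \<le> cone_sup M \<Phi> f u + cone_sup M \<Phi> f w"
      using cone_sup_upper[OF f u yz(1) ae(1)] cone_sup_upper[OF f w yz(2) ae(2)] by simp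
  qed
  moreover have "cone_sup M \<Phi> f u \<le> cone_sup M \<Phi> f (\<lambda>t. u t + w t) - cone_sup M \<Phi> f w"
  proof (rule cone_sup_least[OF M u])
    fix x assume x: "x \<in> mo_space M \<Phi>" "AE t in M. 0 \<le> x t \<and> x t \<le> u t"
    have "cone_sup M \<Phi> f w \<le> cone_sup M \<Phi> f (\<lambda>t. u t + w t) - f x"
    proof (rule cone_sup_least[OF M w])
      fix y assume y: "y \<in> mo_space M \<Phi>" "AE t in M. 0 \<le> y t \<and> y t \<le> w t"
      have "f (\<lambda>t. x t + y t) \<le> cone_sup M \<Phi> f (\<lambda>t. u t + w t)"
      proof (rule cone_sup_upper[OF f uw])
        show "(\<lambda>t. x t + y t) \<in> mo_space M \<Phi>"
          using mo_space_lincomb[OF M x(1) y(1), of 1 1] by simp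
        show "AE t in M. 0 \<le> x t + y t \<and> x t + y t \<le> u t + w t"
          using x(2) y(2) by eventually_elim auto
      qed
      then show "f y \<le> cone_sup M \<Phi> f (\<lambda>t. u t + w t) - f x" using lin[OF x(1) y(1)] by simp
    qed
    then show "f x \<le> cone_sup M \<Phi> f (\<lambda>t. u t + w t) - cone_sup M \<Phi> f w" by simp
  qed
  ultimately show "positive_part M \<Phi> f (\<lambda>t. u t + w t) = positive_part M \<Phi> f u + positive_part M \<Phi> f w"
    by (simp add: positive_part_cone[OF M f] u w uw)
qed

lemma cone_additive_negative_part:
  "musielak_orlicz M \<Phi> \<Longrightarrow> order_bounded M \<Phi> f \<Longrightarrow> cone_additive M \<Phi> (negative_part M \<Phi> f)"
  unfolding negative_part_def by (intro cone_additive_positive_part order_bounded_uminus)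

section \<open>Additivity of the infimum over increasing sequences\<close>

lemma cone_inf_le:
  assumes "cone_mono M \<Phi> p" "u \<in> pos_cone M \<Phi>"
  shows "cone_inf M \<Phi> p u \<le> p u"
  using cone_inf_lower[OF assms increases_to_const[OF assms(2)]] by simp

lemma cone_inf_nonneg:
  assumes p: "cone_mono M \<Phi> p" and u: "u \<in> pos_cone M \<Phi>"
  shows "0 \<le> cone_inf M \<Phi> p u"
proof (rule cone_inf_greatest[OF u])
  fix w assume w: "increases_to M \<Phi> w u"
  show "0 \<le> (SUP n. p (w n))"
    by (rule LIMSEQ_le_const[OF increases_to_tendsto[OF p u w]])
      (use p increases_to_cone[OF w] in \<open>auto simp: cone_mono_def\<close>)
qed

lemma increases_to_le_SUP:
  assumes p: "cone_mono M \<Phi> p" and u: "u \<in> pos_cone M \<Phi>" and w: "increases_to M \<Phi> w u"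
  shows "p (w n) \<le> (SUP n. p (w n))"
  using incseq_le[OF increases_to_incseq[OF p w] increases_to_tendsto[OF p u w]] .

lemma cone_inf_approx:
  assumes u: "u \<in> pos_cone M \<Phi>" and "0 < (e::real)"
  shows "\<exists>w. increases_to M \<Phi> w u \<and> (SUP n. p (w n)) < cone_inf M \<Phi> p u + e"
proof (rule ccontr)
  assume "\<not> ?thesis"
  then have "cone_inf M \<Phi> p u + e \<le> cone_inf M \<Phi> p u"
    by (intro cone_inf_greatest[OF u]) (auto simp: not_less)
  then show False using assms(2) by simp
qed

lemma increases_to_add:
  assumes M: "musielak_orlicz M \<Phi>" and y: "increases_to M \<Phi> y u" and z: "increases_to M \<Phi> z w"
  shows "increases_to M \<Phi> (\<lambda>n t. y n t + z n t) (\<lambda>t. u t + w t)"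
  unfolding increases_to_def
proof
  show "\<forall>n. (\<lambda>t. y n t + z n t) \<in> mo_space M \<Phi>"
    using pos_cone_add[OF M increases_to_cone[OF y] increases_to_cone[OF z]] by (simp add: pos_cone_def)
  have "AE t in M. 0 \<le> y 0 t \<and> incseq (\<lambda>n. y n t) \<and> (\<lambda>n. y n t) \<longlonglongrightarrow> u t"
    "AE t in M. 0 \<le> z 0 t \<and> incseq (\<lambda>n. z n t) \<and> (\<lambda>n. z n t) \<longlonglongrightarrow> w t"
    using y z by (auto simp: increases_to_def)
  then show "AE t in M. 0 \<le> y 0 t + z 0 t \<and> incseq (\<lambda>n. y n t + z n t) \<and> (\<lambda>n. y n t + z n t) \<longlonglongrightarrow> u t + w t"
    by eventually_elim (auto simp: incseq_def intro!: tendsto_add add_mono)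
qed

text \<open>Sums of competing sequences for u and w compete for u + w, which gives one inequality.
  Conversely, a sequence x_n increasing to u + w splits into min x_n u, increasing to u, and max 0
  (x_n - u), increasing to w.\<close>

lemma cone_additive_cone_inf:
  assumes M: "musielak_orlicz M \<Phi>" and p: "cone_additive M \<Phi> p"
  shows "cone_additive M \<Phi> (cone_inf M \<Phi> p)"
  unfolding cone_additive_def
proof (intro conjI ballI)
  note pm = cone_additive_mono[OF M p]
  fix u assume u: "u \<in> pos_cone M \<Phi>"
  show "0 \<le> cone_inf M \<Phi> p u" by (rule cone_inf_nonneg[OF pm u])
  fix w assume w: "w \<in> pos_cone M \<Phi>"
  have uw: "(\<lambda>t. u t + w t) \<in> pos_cone M \<Phi>" by (rule pos_cone_add[OF M u w])
  have um: "u \<in> mo_space M \<Phi>" "w \<in> mo_space M \<Phi>" "AE t in M. 0 \<le> u t" "AE t in M. 0 \<le> w t"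
    using u w by (auto simp: pos_cone_def)
  note [measurable] = mo_space_measurable[OF um(1)] mo_space_measurable[OF um(2)]
  have split: "(SUP n. p (\<lambda>t. y n t + z n t)) = (SUP n. p (y n)) + (SUP n. p (z n))"
    if y: "increases_to M \<Phi> y u" and z: "increases_to M \<Phi> z w" for y z
  proof (rule LIMSEQ_unique)
    show "(\<lambda>n. p (\<lambda>t. y n t + z n t)) \<longlonglongrightarrow> (SUP n. p (\<lambda>t. y n t + z n t))"
      by (rule increases_to_tendsto[OF pm uw increases_to_add[OF M y z]])
    show "(\<lambda>n. p (\<lambda>t. y n t + z n t)) \<longlonglongrightarrow> (SUP n. p (y n)) + (SUP n. p (z n))"
      using tendsto_add[OF increases_to_tendsto[OF pm u y] increases_to_tendsto[OF pm w z]]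
      by (simp add: cone_additive_add[OF p increases_to_cone[OF y] increases_to_cone[OF z]])
  qed
  have le: "cone_inf M \<Phi> p (\<lambda>t. u t + w t) \<le> (SUP n. p (y n)) + (SUP n. p (z n))"
    if y: "increases_to M \<Phi> y u" and z: "increases_to M \<Phi> z w" for y z
    using cone_inf_lower[OF pm uw increases_to_add[OF M y z]] split[OF y z] by simp
  have "cone_inf M \<Phi> p (\<lambda>t. u t + w t) - (SUP n. p (z n)) \<le> cone_inf M \<Phi> p u"
    if "increases_to M \<Phi> z w" for z
    by (rule cone_inf_greatest[OF u]) (use le that in \<open>auto simp: algebra_simps\<close>)
  then have "cone_inf M \<Phi> p (\<lambda>t. u t + w t) - cone_inf M \<Phi> p u \<le> cone_inf M \<Phi> p w"
    by (intro cone_inf_greatest[OF w]) (auto simp: algebra_simps)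
  moreover have "cone_inf M \<Phi> p u + cone_inf M \<Phi> p w \<le> cone_inf M \<Phi> p (\<lambda>t. u t + w t)"
  proof (rule cone_inf_greatest[OF uw])
    fix x assume x: "increases_to M \<Phi> x (\<lambda>t. u t + w t)"
    have xm[measurable]: "x n \<in> borel_measurable M" for n
      using x by (simp add: increases_to_def mo_space_def)
    define y where "y n t = min (x n t) (u t)" for n t
    define z where "z n t = x n t - y n t" for n t
    have ae: "AE t in M. 0 \<le> x 0 t \<and> incseq (\<lambda>n. x n t) \<and> (\<lambda>n. x n t) \<longlonglongrightarrow> u t + w t"
      using x by (simp add: increases_to_def)
    have xn: "AE t in M. 0 \<le> x n t \<and> x n t \<le> u t + w t" for n
      using increases_to_cone[OF x, of n] increases_to_le[OF x, of n] by (simp add: pos_cone_def)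
    have y: "increases_to M \<Phi> y u" unfolding increases_to_def
    proof
      have "y n \<in> mo_space M \<Phi>" for n
        by (rule mo_space_solid[OF M um(1)])
          (unfold y_def, measurable, use xn[of n] um(3) in eventually_elim, auto simp: y_def)
      then show "\<forall>n. y n \<in> mo_space M \<Phi>" ..
      show "AE t in M. 0 \<le> y 0 t \<and> incseq (\<lambda>n. y n t) \<and> (\<lambda>n. y n t) \<longlonglongrightarrow> u t"
        using ae um(3,4)
      proof eventually_elim
        case (elim t)
        have "(\<lambda>n. min (x n t) (u t)) \<longlonglongrightarrow> min (u t + w t) (u t)" using elim by (intro tendsto_min) auto
        moreover have "incseq (\<lambda>n. min (x n t) (u t))"
          unfolding incseq_def by (intro allI impI min.mono) (use elim in \<open>auto simp: incseq_def\<close>)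
        ultimately show ?case using elim by (simp add: y_def)
      qed
    qed
    have z: "increases_to M \<Phi> z w" unfolding increases_to_def
    proof
      have "z n \<in> mo_space M \<Phi>" for n
        by (rule mo_space_solid[OF M um(2)])
          (unfold z_def y_def, measurable, use xn[of n] um(4) in eventually_elim, auto simp: y_def z_def)
      then show "\<forall>n. z n \<in> mo_space M \<Phi>" ..
      show "AE t in M. 0 \<le> z 0 t \<and> incseq (\<lambda>n. z n t) \<and> (\<lambda>n. z n t) \<longlonglongrightarrow> w t"
        using ae um(3,4)
      proof eventually_elim
        case (elim t)
        have *: "z n t = max 0 (x n t - u t)" for n by (auto simp: z_def y_def)
        have "(\<lambda>n. max 0 (x n t - u t)) \<longlonglongrightarrow> max 0 (u t + w t - u t)"
          using elim by (intro tendsto_max tendsto_diff tendsto_const) auto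
        moreover have "incseq (\<lambda>n. max 0 (x n t - u t))"
          unfolding incseq_def by (intro allI impI max.mono) (use elim in \<open>auto simp: incseq_def\<close>)
        ultimately show ?case using elim by (simp add: *)
      qed
    qed
    have "(\<lambda>t. y n t + z n t) = x n" for n by (simp add: z_def)
    then have "(SUP n. p (x n)) = (SUP n. p (y n)) + (SUP n. p (z n))"
      using split[OF y z] by simp
    then show "cone_inf M \<Phi> p u + cone_inf M \<Phi> p w \<le> (SUP n. p (x n))"
      using cone_inf_lower[OF pm u y] cone_inf_lower[OF pm w z] by simp
  qed
  ultimately show "cone_inf M \<Phi> p (\<lambda>t. u t + w t) = cone_inf M \<Phi> p u + cone_inf M \<Phi> p w" by simp
qed

text \<open>The difference is the singular part p_s of \<open>p\<close>. It is nonnegative because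
  the constant sequence u competes in the infimum.\<close>

lemma cone_additive_singular:
  assumes M: "musielak_orlicz M \<Phi>" and p: "cone_additive M \<Phi> p"
  shows "cone_additive M \<Phi> (\<lambda>u. p u - cone_inf M \<Phi> p u)"
  using p cone_additive_cone_inf[OF M p] cone_inf_le[OF cone_additive_mono[OF M p]]
  by (simp add: cone_additive_def)

section \<open>Order continuity of \<open>cone_inf\<close>\<close>

lemma diagonal_sum_tendsto:
  fixes w :: "nat \<Rightarrow> nat \<Rightarrow> real"
  assumes w: "\<And>j. incseq (w j)" "\<And>j n. 0 \<le> w j n" "\<And>j. w j \<longlonglongrightarrow> d j"
    and d: "(\<lambda>n. \<Sum>j\<le>n. d j) \<longlonglongrightarrow> u"
  shows "incseq (\<lambda>n. \<Sum>j\<le>n. w j n)" "(\<lambda>n. \<Sum>j\<le>n. w j n) \<longlonglongrightarrow> u"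
proof -
  show inc: "incseq (\<lambda>n. \<Sum>j\<le>n. w j n)" unfolding incseq_def
  proof (intro allI impI)
    fix m n :: nat assume "m \<le> n"
    then have "(\<Sum>j\<le>m. w j m) \<le> (\<Sum>j\<le>m. w j n)" by (intro sum_mono incseqD[OF w(1)])
    also have "\<dots> \<le> (\<Sum>j\<le>n. w j n)" using \<open>m \<le> n\<close> w(2) by (intro sum_mono2) auto
    finally show "(\<Sum>j\<le>m. w j m) \<le> (\<Sum>j\<le>n. w j n)" .
  qed
  have wd: "w j n \<le> d j" for j n by (rule incseq_le[OF w(1) w(3)])
  then have d0: "0 \<le> d j" for j using w(2) order_trans by blast
  have incd: "incseq (\<lambda>n. \<Sum>j\<le>n. d j)"
    unfolding incseq_def using d0 by (intro allI impI sum_mono2) auto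
  have le: "(\<Sum>j\<le>n. w j n) \<le> u" for n
    using sum_mono[of "{..n}" "\<lambda>j. w j n" d] wd incseq_le[OF incd d, of n] by simp
  obtain L where L: "(\<lambda>n. \<Sum>j\<le>n. w j n) \<longlonglongrightarrow> L"
    using incseq_convergent[OF inc, of u] le by blast
  \<comment> \<open>Fixing the number k of summands before n grows turns the limit of the diagonal
    sums into a bound for every partial sum of the d_j.\<close>
  have "(\<Sum>j\<le>k. d j) \<le> L" for k
  proof (rule LIMSEQ_le[OF _ L])
    show "(\<lambda>n. \<Sum>j\<le>k. w j n) \<longlonglongrightarrow> (\<Sum>j\<le>k. d j)" by (intro tendsto_sum w(3))
    show "\<exists>N. \<forall>n\<ge>N. (\<Sum>j\<le>k. w j n) \<le> (\<Sum>j\<le>n. w j n)"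
      using w(2) by (intro exI[of _ k] allI impI sum_mono2) auto
  qed
  then have "u \<le> L" by (intro LIMSEQ_le_const2[OF d]) auto
  moreover have "L \<le> u" by (rule LIMSEQ_le_const2[OF L]) (use le in auto)
  ultimately show "(\<lambda>n. \<Sum>j\<le>n. w j n) \<longlonglongrightarrow> u" using L by simp
qed

text \<open>Write \<open>z\<^sub>n\<close> as the sum of its increments \<open>d\<^sub>j\<close>, approximate each \<open>d\<^sub>j\<close> from below up to
  \<open>e / 2 ^ (j + 1)\<close>, and add the approximations up diagonally.\<close>

lemma cone_inf_order_continuous:
  assumes M: "musielak_orlicz M \<Phi>" and p: "cone_additive M \<Phi> p"
    and u: "u \<in> pos_cone M \<Phi>" and z: "increases_to M \<Phi> z u"
  shows "(\<lambda>n. cone_inf M \<Phi> p (z n)) \<longlonglongrightarrow> cone_inf M \<Phi> p u"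
proof -
  let ?c = "cone_inf M \<Phi> p"
  note pm = cone_additive_mono[OF M p]
  note c = cone_additive_cone_inf[OF M p]
  note cm = cone_additive_mono[OF M c]
  note zc = increases_to_cone[OF z]
  \<comment> \<open>The increment with index 0 is \<open>z 0\<close> itself, so that the sum over j
    <= n telescopes to exactly \<open>z n\<close>.\<close>
  define d where "d j t = (if j = 0 then z 0 t else z j t - z (j - 1) t)" for j t
  have aez: "AE t in M. 0 \<le> z 0 t \<and> incseq (\<lambda>n. z n t) \<and> (\<lambda>n. z n t) \<longlonglongrightarrow> u t"
    using z by (simp add: increases_to_def)
  have dc: "d j \<in> pos_cone M \<Phi>" for j
  proof (cases j)
    case 0
    then have "d j = z 0" by (auto simp: d_def)
    then show ?thesis using zc by simp
  next
    case (Suc k)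
    then have *: "d j = (\<lambda>t. z (Suc k) t - z k t)" by (auto simp: d_def)
    have "AE t in M. z k t \<le> z (Suc k) t" using aez by eventually_elim (blast dest: incseq_SucD)
    then show ?thesis unfolding * by (rule pos_cone_diff[OF M zc zc])
  qed
  have zd: "z n t = (\<Sum>j\<le>n. d j t)" for n t by (induction n) (auto simp: d_def)
  have cz: "?c (z n) = (\<Sum>j\<le>n. ?c (d j))" for n
  proof -
    have "z n = (\<lambda>t. \<Sum>j\<le>n. d j t)" by (rule ext) (rule zd)
    then show ?thesis using cone_additive_sum[OF M c dc] by simp
  qed
  let ?L = "SUP n. ?c (z n)"
  have lim: "(\<lambda>n. ?c (z n)) \<longlonglongrightarrow> ?L" by (rule increases_to_tendsto[OF cm u z])
  have "?L \<le> ?c u"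
    by (rule LIMSEQ_le_const2[OF lim])
      (use cone_mono_le[OF cm zc u increases_to_le[OF z]] in auto)
  moreover have "?c u \<le> ?L + e" if e: "0 < e" for e :: real
  proof -
    have "\<forall>j. \<exists>w. increases_to M \<Phi> w (d j) \<and> (SUP n. p (w n)) < ?c (d j) + e * (1/2) ^ Suc j"
      using cone_inf_approx[OF dc] e by simp
    then obtain w where w: "\<And>j. increases_to M \<Phi> (w j) (d j)"
      "\<And>j. (SUP n. p (w j n)) < ?c (d j) + e * (1/2) ^ Suc j" by metis
    note wc = increases_to_cone[OF w(1)]
    define y where "y n t = (\<Sum>j\<le>n. w j n t)" for n t
    have y: "increases_to M \<Phi> y u" unfolding increases_to_def
    proof
      have "y n \<in> pos_cone M \<Phi>" for n
        unfolding y_def by (rule pos_cone_sum[OF M wc])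
      then show "\<forall>n. y n \<in> mo_space M \<Phi>" by (simp add: pos_cone_def)
      have "AE t in M. \<forall>j. 0 \<le> w j 0 t \<and> incseq (\<lambda>n. w j n t) \<and> (\<lambda>n. w j n t) \<longlonglongrightarrow> d j t"
        using w(1) by (simp add: AE_all_countable increases_to_def)
      then show "AE t in M. 0 \<le> y 0 t \<and> incseq (\<lambda>n. y n t) \<and> (\<lambda>n. y n t) \<longlonglongrightarrow> u t"
        using aez
      proof eventually_elim
        case (elim t)
        have 0: "0 \<le> w j n t" for j n using elim incseqD[of "\<lambda>n. w j n t" 0 n] by (meson le0 order_trans)
        have 1: "incseq (\<lambda>n. w j n t)" "(\<lambda>n. w j n t) \<longlonglongrightarrow> d j t" for j using elim by auto
        have "(\<lambda>n. \<Sum>j\<le>n. d j t) \<longlonglongrightarrow> u t" using elim by (simp add: zd[symmetric])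
        note diagonal_sum_tendsto[of "\<lambda>j n. w j n t", OF 1(1) 0 1(2) this]
        then show ?case using 0 by (simp add: y_def)
      qed
    qed
    \<comment> \<open>Since \<open>y\<close> competes in the infimum defining p_c u, it is enough to
      bound \<open>p\<close> along \<open>y\<close>. Additivity of \<open>p\<close> and of p_c
      collects the increments into p_c (z_n) plus a total error of at most e.\<close>
    have "p (y n) \<le> ?L + e" for n
    proof -
      have geo: "(\<Sum>j\<le>n. (1/2::real) ^ Suc j) \<le> 1"
      proof -
        have "(\<Sum>j\<le>n. (1/2::real) ^ Suc j) = 1 - (1/2) ^ Suc n" by (induction n) auto
        then show ?thesis by simp
      qed
      have "p (y n) = (\<Sum>j\<le>n. p (w j n))"
        unfolding y_def by (rule cone_additive_sum[OF M p wc])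
      also have "\<dots> \<le> (\<Sum>j\<le>n. ?c (d j) + e * (1/2) ^ Suc j)"
        by (intro sum_mono) (meson increases_to_le_SUP[OF pm dc w(1)] w(2) less_imp_le order_trans)
      also have "\<dots> = ?c (z n) + e * (\<Sum>j\<le>n. (1/2) ^ Suc j)"
        by (simp add: sum.distrib sum_distrib_left cz)
      also have "\<dots> \<le> ?L + e * 1"
        by (intro add_mono mult_left_mono geo increases_to_le_SUP[OF cm u z]) (use e in auto)
      finally show ?thesis by simp
    qed
    then have "(SUP n. p (y n)) \<le> ?L + e" by (intro cSUP_least) auto
    then show ?thesis using cone_inf_lower[OF pm u y] by simp
  qed
  then have "?c u \<le> ?L" by (rule field_le_epsilon)
  ultimately show ?thesis using lim by simp
qed

section \<open>Sets decreasing to a null set\<close>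

definition vanishing_sets :: "'a measure \<Rightarrow> (nat \<Rightarrow> 'a set) \<Rightarrow> bool" where
  "vanishing_sets M E \<longleftrightarrow> (\<forall>n. E n \<in> sets M) \<and>
    (AE t in M. (\<forall>m n. m \<le> n \<longrightarrow> t \<in> E n \<longrightarrow> t \<in> E m) \<and> (\<exists>n. t \<notin> E n))"

lemma vanishing_sets_tendsto:
  assumes "vanishing_sets M E"
  shows "AE t in M. eventually (\<lambda>n. t \<notin> E n) sequentially"
proof -
  have "AE t in M. (\<forall>m n. m \<le> n \<longrightarrow> t \<in> E n \<longrightarrow> t \<in> E m) \<and> (\<exists>n. t \<notin> E n)"
    using assms by (simp add: vanishing_sets_def)
  then show ?thesis by eventually_elim (auto simp: eventually_sequentially)
qed

lemma restrict_pos_cone: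
  assumes M: "musielak_orlicz M \<Phi>" and u: "u \<in> pos_cone M \<Phi>" and E: "E \<in> sets M"
  shows "(\<lambda>t. u t * indicator E t) \<in> pos_cone M \<Phi>" "(\<lambda>t. u t * (1 - indicator E t)) \<in> pos_cone M \<Phi>"
proof -
  have um: "u \<in> mo_space M \<Phi>" and pos: "AE t in M. 0 \<le> u t" using u by (auto simp: pos_cone_def)
  note [measurable] = mo_space_measurable[OF um] E
  show "(\<lambda>t. u t * indicator E t) \<in> pos_cone M \<Phi>"
    by (rule pos_cone_solid[OF M um], measurable)
      (use pos in eventually_elim, auto simp: indicator_def)
  show "(\<lambda>t. u t * (1 - indicator E t)) \<in> pos_cone M \<Phi>"
    by (rule pos_cone_solid[OF M um], measurable)
      (use pos in eventually_elim, auto simp: indicator_def)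
qed

lemma restrict_mo_space:
  assumes M: "musielak_orlicz M \<Phi>" and u: "u \<in> mo_space M \<Phi>" and E: "E \<in> sets M"
  shows "(\<lambda>t. u t * indicator E t) \<in> mo_space M \<Phi>" "(\<lambda>t. u t * (1 - indicator E t)) \<in> mo_space M \<Phi>"
proof -
  note [measurable] = mo_space_measurable[OF u] E
  show "(\<lambda>t. u t * indicator E t) \<in> mo_space M \<Phi>"
    by (rule mo_space_solid[OF M u]) (auto simp: indicator_def)
  show "(\<lambda>t. u t * (1 - indicator E t)) \<in> mo_space M \<Phi>"
    by (rule mo_space_solid[OF M u]) (auto simp: indicator_def)
qed

lemma cone_additive_restrict:
  assumes M: "musielak_orlicz M \<Phi>" and p: "cone_additive M \<Phi> p" and u: "u \<in> pos_cone M \<Phi>"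
    and E: "E \<in> sets M"
  shows "p u = p (\<lambda>t. u t * indicator E t) + p (\<lambda>t. u t * (1 - indicator E t))"
  using cone_additive_add[OF p restrict_pos_cone[OF M u E]] by (simp add: algebra_simps)

text \<open>The restrictions of u to the complements of the E_n increase to u, so by order
  continuity their p_c tends to p_c u. By additivity, the remainder is p_c of u restricted to
  E_n.\<close>

lemma cone_inf_vanishing:
  assumes M: "musielak_orlicz M \<Phi>" and p: "cone_additive M \<Phi> p" and u: "u \<in> pos_cone M \<Phi>"
    and E: "vanishing_sets M E"
  shows "(\<lambda>n. cone_inf M \<Phi> p (\<lambda>t. u t * indicator (E n) t)) \<longlonglongrightarrow> 0"
proof -
  have Em: "\<And>n. E n \<in> sets M"
    and ae: "AE t in M. (\<forall>m n. m \<le> n \<longrightarrow> t \<in> E n \<longrightarrow> t \<in> E m) \<and> (\<exists>n. t \<notin> E n)"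
    using E by (auto simp: vanishing_sets_def)
  have pos: "AE t in M. 0 \<le> u t" using u by (simp add: pos_cone_def)
  have "increases_to M \<Phi> (\<lambda>n t. u t * (1 - indicator (E n) t)) u" unfolding increases_to_def
  proof
    show "\<forall>n. (\<lambda>t. u t * (1 - indicator (E n) t)) \<in> mo_space M \<Phi>"
      using restrict_pos_cone(2)[OF M u Em] by (simp add: pos_cone_def)
    show "AE t in M. 0 \<le> u t * (1 - indicator (E 0) t) \<and> incseq (\<lambda>n. u t * (1 - indicator (E n) t)) \<and>
        (\<lambda>n. u t * (1 - indicator (E n) t)) \<longlonglongrightarrow> u t"
      using ae vanishing_sets_tendsto[OF E] pos
    proof eventually_elim
      case (elim t)
      have "eventually (\<lambda>n. u t * (1 - indicator (E n) t) = u t) sequentially"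
        using elim(2) by eventually_elim simp
      then have "(\<lambda>n. u t * (1 - indicator (E n) t)) \<longlonglongrightarrow> u t" by (rule tendsto_eventually)
      moreover have "incseq (\<lambda>n. u t * (1 - indicator (E n) t))"
        unfolding incseq_def using elim by (auto simp: indicator_def)
      ultimately show ?case using elim by (auto simp: indicator_def)
    qed
  qed
  from cone_inf_order_continuous[OF M p u this]
  have "(\<lambda>n. cone_inf M \<Phi> p u - cone_inf M \<Phi> p (\<lambda>t. u t * (1 - indicator (E n) t)))
      \<longlonglongrightarrow> cone_inf M \<Phi> p u - cone_inf M \<Phi> p u"
    by (intro tendsto_diff tendsto_const)
  moreover have "cone_inf M \<Phi> p u - cone_inf M \<Phi> p (\<lambda>t. u t * (1 - indicator (E n) t)) =
      cone_inf M \<Phi> p (\<lambda>t. u t * indicator (E n) t)" for n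
    using cone_additive_restrict[OF M cone_additive_cone_inf[OF M p] u Em[of n]] by simp
  ultimately show ?thesis by simp
qed

text \<open>If \<open>w\<^sub>n \<up> u\<close> nearly attains the infimum \<open>p\<^sub>c u\<close>, then \<open>p\<^sub>s\<close> is small on every \<open>w\<^sub>n\<close>, hence on
  the part of \<open>u\<close> where \<open>u \<le> 2 w\<^sub>n\<close>.\<close>

lemma singular_concentrated:
  assumes M: "musielak_orlicz M \<Phi>" and p: "cone_additive M \<Phi> p" and u: "u \<in> pos_cone M \<Phi>"
    and e: "0 < (e::real)"
  shows "\<exists>E. vanishing_sets M E \<and> (\<forall>n. p (\<lambda>t. u t * (1 - indicator (E n) t)) -
    cone_inf M \<Phi> p (\<lambda>t. u t * (1 - indicator (E n) t)) \<le> e)"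
proof -
  let ?c = "cone_inf M \<Phi> p" and ?s = "\<lambda>u. p u - cone_inf M \<Phi> p u"
  note pm = cone_additive_mono[OF M p]
  note s = cone_additive_singular[OF M p]
  note sm = cone_additive_mono[OF M s]
  obtain w where w: "increases_to M \<Phi> w u" "(SUP n. p (w n)) < ?c u + e / 2"
    using cone_inf_approx[OF u, of "e / 2"] e by auto
  note wc = increases_to_cone[OF w(1)]
  \<comment> \<open>By monotonicity, p_s (w_n) <= p_s (w_m) = p (w_m) - p_c (w_m) for m >= n. The
    first term stays below p_c u + e / 2 and the second tends to p_c u, which leaves e / 2.\<close>
  have sw: "?s (w n) \<le> e / 2" for n
  proof -
    have lim: "(\<lambda>m. (?c u + e / 2) - ?c (w m)) \<longlonglongrightarrow> (?c u + e / 2) - ?c u"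
      by (intro tendsto_diff tendsto_const cone_inf_order_continuous[OF M p u w(1)])
    have "?s (w n) \<le> (?c u + e / 2) - ?c (w m)" if "n \<le> m" for m
      using incseqD[OF increases_to_incseq[OF sm w(1)] that]
        increases_to_le_SUP[OF pm u w(1), of m] w(2) by simp
    then have "?s (w n) \<le> (?c u + e / 2) - ?c u"
      by (intro LIMSEQ_le_const[OF lim]) auto
    then show ?thesis by simp
  qed
  \<comment> \<open>Off E_n one has u <= 2 w_n, so the error e / 2 doubles to e. A point in all E_n
    would have u > 0, as w_0 >= 0, and in the limit u <= u / 2. Both this and the monotonicity of
    E_n fail at most on the null set where \<open>w\<close> does not increase to u, hence the almost
    everywhere form of \<open>vanishing_sets\<close>.\<close>
  define E where "E n = {t \<in> space M. w n t < u t / 2}" for n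
  have [measurable]: "u \<in> borel_measurable M" "\<And>n. w n \<in> borel_measurable M"
    using u wc by (auto simp: pos_cone_def mo_space_def)
  have Em: "E n \<in> sets M" for n unfolding E_def by measurable
  have aew: "AE t in M. 0 \<le> w 0 t \<and> incseq (\<lambda>n. w n t) \<and> (\<lambda>n. w n t) \<longlonglongrightarrow> u t"
    using w by (simp add: increases_to_def)
  have "vanishing_sets M E" unfolding vanishing_sets_def
  proof
    show "\<forall>n. E n \<in> sets M" using Em by simp
    show "AE t in M. (\<forall>m n. m \<le> n \<longrightarrow> t \<in> E n \<longrightarrow> t \<in> E m) \<and> (\<exists>n. t \<notin> E n)"
      using aew
    proof eventually_elim
      case (elim t)
      have "\<exists>n. t \<notin> E n"
      proof (rule ccontr)
        assume "\<not> ?thesis"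
        then have lt: "w n t < u t / 2" for n by (auto simp: E_def)
        then have "u t \<le> u t / 2" using elim by (intro LIMSEQ_le_const2[of "\<lambda>n. w n t"]) (auto intro: less_imp_le)
        with lt[of 0] elim show False by linarith
      qed
      moreover have "t \<in> E m" if "m \<le> n" "t \<in> E n" for m n
        using that incseqD[of "\<lambda>n. w n t" m n] elim by (auto simp: E_def)
      ultimately show ?case by blast
    qed
  qed
  moreover have "?s (\<lambda>t. u t * (1 - indicator (E n) t)) \<le> e" for n
  proof -
    have "?s (\<lambda>t. u t * (1 - indicator (E n) t)) \<le> ?s (\<lambda>t. w n t + w n t)"
    proof (rule cone_mono_le[OF sm restrict_pos_cone(2)[OF M u Em] pos_cone_add[OF M wc wc]])
      have "AE t in M. 0 \<le> w n t" using wc by (simp add: pos_cone_def)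
      then show "AE t in M. u t * (1 - indicator (E n) t) \<le> w n t + w n t"
        using AE_space by eventually_elim (auto simp: E_def indicator_def)
    qed
    then show ?thesis using cone_additive_add[OF s wc[of n] wc[of n]] sw[of n] by simp
  qed
  ultimately show ?thesis by (intro exI[of _ E]) simp
qed

section \<open>The components\<close>

lemma mo_dual_lincomb:
  "f \<in> mo_dual M \<Phi> \<Longrightarrow> u \<in> mo_space M \<Phi> \<Longrightarrow> w \<in> mo_space M \<Phi> \<Longrightarrow>
    f (\<lambda>t. a * u t + b * w t) = a * f u + b * f w"
  by (simp add: mo_dual_def)

text \<open>The modulus |f| of \<open>f\<close> on the cone. Estimating both components through this
  one positive functional lets a single sequence of sets serve for the positive and the negative
  part of \<open>f\<close>.\<close>

definition cone_abs ::
    "'a measure \<Rightarrow> ('a \<Rightarrow> ennreal \<Rightarrow> ennreal) \<Rightarrow> (('a \<Rightarrow> real) \<Rightarrow> real) \<Rightarrow> ('a \<Rightarrow> real) \<Rightarrow> real" where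
  "cone_abs M \<Phi> f u = positive_part M \<Phi> f u + negative_part M \<Phi> f u"

lemma cone_additive_cone_abs:
  assumes "musielak_orlicz M \<Phi>" "f \<in> mo_dual M \<Phi>"
  shows "cone_additive M \<Phi> (cone_abs M \<Phi> f)"
  unfolding cone_abs_def[abs_def]
  by (rule cone_additive_plus[OF cone_additive_positive_part cone_additive_negative_part])
    (intro order_bounded_dual assms)+

lemma cone_inf_cone_abs:
  assumes M: "musielak_orlicz M \<Phi>" and f: "f \<in> mo_dual M \<Phi>" and u: "u \<in> pos_cone M \<Phi>"
  shows "cone_inf M \<Phi> (cone_abs M \<Phi> f) u =
    cone_inf M \<Phi> (positive_part M \<Phi> f) u + cone_inf M \<Phi> (negative_part M \<Phi> f) u"
  using cone_inf_add[OF M cone_mono_positive_part cone_mono_negative_part u] M order_bounded_dual[OF M f]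
  by (simp add: cone_abs_def[abs_def])

lemma abs_parts: "(\<lambda>t. max (u t) 0 + max (- u t) 0) = (\<lambda>t. \<bar>u t :: real\<bar>)"
  by (auto simp: max_def abs_if)

text \<open>Positive and negative parts of \<open>f\<close> and of u write f_c u as a signed sum of
  four nonnegative terms; the bound is the same sum with all signs positive.\<close>

lemma order_continuous_component_bound:
  assumes M: "musielak_orlicz M \<Phi>" and f: "f \<in> mo_dual M \<Phi>" and u: "u \<in> mo_space M \<Phi>"
  shows "\<bar>order_continuous_component M \<Phi> f u\<bar> \<le> cone_inf M \<Phi> (cone_abs M \<Phi> f) (\<lambda>t. \<bar>u t\<bar>)"
proof -
  note ob = order_bounded_dual[OF M f]
  note p = cone_mono_positive_part[OF M ob] and q = cone_mono_negative_part[OF M ob]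
  note c = pos_cone_parts(1,2)[OF M u]
  have "cone_inf M \<Phi> (cone_abs M \<Phi> f) (\<lambda>t. \<bar>u t\<bar>) =
      cone_inf M \<Phi> (cone_abs M \<Phi> f) (\<lambda>t. max (u t) 0) + cone_inf M \<Phi> (cone_abs M \<Phi> f) (\<lambda>t. max (- u t) 0)"
    using cone_additive_add[OF cone_additive_cone_inf[OF M cone_additive_cone_abs[OF M f]] c]
    by (simp add: abs_parts)
  then show ?thesis
    unfolding order_continuous_component_eq
    using cone_inf_cone_abs[OF M f c(1)] cone_inf_cone_abs[OF M f c(2)]
      cone_inf_nonneg[OF p c(1)] cone_inf_nonneg[OF p c(2)]
      cone_inf_nonneg[OF q c(1)] cone_inf_nonneg[OF q c(2)] by linarith
qed

text \<open>On the cone f = f^+ - f^-, so f_s u is a signed sum of the singular parts of f^+ and f^-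
  at the positive and negative parts of u. Each of these four terms is nonnegative because p_c <=
  p.\<close>

lemma singular_component_bound:
  assumes M: "musielak_orlicz M \<Phi>" and f: "f \<in> mo_dual M \<Phi>" and u: "u \<in> mo_space M \<Phi>"
  shows "\<bar>singular_component M \<Phi> f u\<bar> \<le>
    cone_abs M \<Phi> f (\<lambda>t. \<bar>u t\<bar>) - cone_inf M \<Phi> (cone_abs M \<Phi> f) (\<lambda>t. \<bar>u t\<bar>)"
proof -
  note ob = order_bounded_dual[OF M f]
  note p = cone_mono_positive_part[OF M ob] and q = cone_mono_negative_part[OF M ob]
  note c = pos_cone_parts(1,2)[OF M u]
  have cm: "(\<lambda>t. max (u t) 0) \<in> mo_space M \<Phi>" "(\<lambda>t. max (- u t) 0) \<in> mo_space M \<Phi>"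
    using c by (auto simp: pos_cone_def)
  have "(\<lambda>t. 1 * max (u t) 0 + (-1) * max (- u t) 0) = u" by (auto simp: max_def)
  then have "f u = f (\<lambda>t. max (u t) 0) - f (\<lambda>t. max (- u t) 0)"
    using mo_dual_lincomb[OF f cm, of 1 "-1"] by simp
  moreover note negative_part_cone[OF M ob c(1)] negative_part_cone[OF M ob c(2)]
  moreover have "cone_abs M \<Phi> f (\<lambda>t. \<bar>u t\<bar>) - cone_inf M \<Phi> (cone_abs M \<Phi> f) (\<lambda>t. \<bar>u t\<bar>) =
      (cone_abs M \<Phi> f (\<lambda>t. max (u t) 0) - cone_inf M \<Phi> (cone_abs M \<Phi> f) (\<lambda>t. max (u t) 0)) +
      (cone_abs M \<Phi> f (\<lambda>t. max (- u t) 0) - cone_inf M \<Phi> (cone_abs M \<Phi> f) (\<lambda>t. max (- u t) 0))"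
    using cone_additive_add[OF cone_additive_singular[OF M cone_additive_cone_abs[OF M f]] c]
    by (simp add: abs_parts)
  ultimately show ?thesis
    unfolding singular_component_def order_continuous_component_eq
    using cone_inf_cone_abs[OF M f c(1)] cone_inf_cone_abs[OF M f c(2)]
      cone_inf_le[OF p c(1)] cone_inf_le[OF p c(2)]
      cone_inf_le[OF q c(1)] cone_inf_le[OF q c(2)]
      cone_abs_def[of M \<Phi> f "\<lambda>t. max (u t) 0"] cone_abs_def[of M \<Phi> f "\<lambda>t. max (- u t) 0"]
    by linarith
qed

text \<open>Restriction to a set commutes with taking positive and negative parts of u, so
  additivity on the cone suffices. This is the form of additivity used for the glued
  functions.\<close>

lemma order_continuous_component_restrict:
  assumes M: "musielak_orlicz M \<Phi>" and f: "f \<in> mo_dual M \<Phi>" and u: "u \<in> mo_space M \<Phi>"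
    and E: "E \<in> sets M"
  shows "order_continuous_component M \<Phi> f u =
    order_continuous_component M \<Phi> f (\<lambda>t. u t * indicator E t) +
    order_continuous_component M \<Phi> f (\<lambda>t. u t * (1 - indicator E t))"
proof -
  note ob = order_bounded_dual[OF M f]
  note p = cone_additive_cone_inf[OF M cone_additive_positive_part[OF M ob]]
    and q = cone_additive_cone_inf[OF M cone_additive_negative_part[OF M ob]]
  note c = pos_cone_parts(1,2)[OF M u]
  have eq: "(\<lambda>t. max (u t * indicator E t) 0) = (\<lambda>t. max (u t) 0 * indicator E t)"
    "(\<lambda>t. max (- (u t * indicator E t)) 0) = (\<lambda>t. max (- u t) 0 * indicator E t)"
    "(\<lambda>t. max (u t * (1 - indicator E t)) 0) = (\<lambda>t. max (u t) 0 * (1 - indicator E t))"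
    "(\<lambda>t. max (- (u t * (1 - indicator E t))) 0) = (\<lambda>t. max (- u t) 0 * (1 - indicator E t))"
    by (auto simp: indicator_def)
  show ?thesis unfolding order_continuous_component_eq eq
    using cone_additive_restrict[OF M p c(1) E] cone_additive_restrict[OF M p c(2) E]
      cone_additive_restrict[OF M q c(1) E] cone_additive_restrict[OF M q c(2) E] by linarith
qed

section \<open>The norms\<close>

lemma modular_scale:
  assumes M: "musielak_orlicz M \<Phi>" and u: "u \<in> borel_measurable M" and a: "0 \<le> a" "a \<le> 1"
  shows "modular M \<Phi> (\<lambda>t. a * u t) \<le> ennreal a * modular M \<Phi> u"
proof -
  obtain h where [measurable]: "h \<in> borel_measurable M" and h: "AE t in M. \<Phi> t (ennreal \<bar>u t\<bar>) = h t"
    using modular_integrand_measurable[OF M u] by auto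
  have "modular M \<Phi> (\<lambda>t. a * u t) \<le> (\<integral>\<^sup>+t. ennreal a * h t \<partial>M)"
    unfolding modular_def
  proof (rule nn_integral_mono_AE, use musielak_orlicz_AE[OF M] h in eventually_elim)
    case (elim t)
    have "ennreal \<bar>a * u t\<bar> = ennreal a * ennreal \<bar>u t\<bar>"
      using a by (simp add: ennreal_mult[symmetric] abs_mult)
    moreover have "ennreal a \<le> 1" using a by simp
    ultimately show ?case using elim by metis
  qed
  also have "\<dots> = ennreal a * modular M \<Phi> u"
    using h by (simp add: nn_integral_cmult modular_def cong: nn_integral_cong_AE)
  finally show ?thesis .
qed

lemma luxemburg_norm_le:
  assumes "0 < c" "modular M \<Phi> (\<lambda>t. u t / c) \<le> 1"
  shows "luxemburg_norm M \<Phi> u \<le> c"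
  unfolding luxemburg_norm_def by (rule cInf_lower) (use assms in \<open>auto intro!: bdd_belowI[of _ 0]\<close>)

lemma modular_le_1_of_luxemburg_norm_less:
  assumes M: "musielak_orlicz M \<Phi>" and u: "u \<in> mo_space M \<Phi>" and c: "luxemburg_norm M \<Phi> u < c"
  shows "modular M \<Phi> (\<lambda>t. u t / c) \<le> 1"
proof -
  have "{c. 0 < c \<and> modular M \<Phi> (\<lambda>t. u t / c) \<le> 1} \<noteq> {}" using modular_le_1_ex[OF M u] by auto
  from cInf_lessD[OF this] c obtain b where b: "0 < b" "b < c" "modular M \<Phi> (\<lambda>t. u t / b) \<le> 1"
    unfolding luxemburg_norm_def by auto
  have "modular M \<Phi> (\<lambda>t. u t / c) \<le> modular M \<Phi> (\<lambda>t. u t / b)"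
    by (rule modular_mono[OF M]) (use b in \<open>auto intro!: divide_left_mono AE_I2\<close>)
  then show ?thesis using b by simp
qed

text \<open>Glued test functions have modular slightly above 1. Since \<Phi>(t, .) is convex and
  vanishes at 0, dividing x by c >= 1 divides the modular by at least c, so a modular bound c is
  also a norm bound.\<close>

lemma dual_norm_upper:
  assumes M: "musielak_orlicz M \<Phi>" and f: "f \<in> mo_dual M \<Phi>" and d: "dual_norm M \<Phi> f \<le> ennreal d" "0 \<le> d"
    and x: "x \<in> mo_space M \<Phi>" and c: "1 \<le> c" and mx: "modular M \<Phi> x \<le> ennreal c"
  shows "f x \<le> d * c"
proof (cases "(AE t in M. x t = 0) \<or> luxemburg_norm M \<Phi> x = 0")
  \<comment> \<open>Null functions are excluded from the supremum in \<open>dual_norm\<close>, and a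
    vanishing norm makes the quotient 0 there, so \<open>d\<close> gives no information. In both
    cases boundedness of \<open>f\<close> forces f x = 0.\<close>
  case True
  obtain C where "\<And>u. u \<in> mo_space M \<Phi> \<Longrightarrow> \<bar>f u\<bar> \<le> C * luxemburg_norm M \<Phi> u"
    using f unfolding mo_dual_def by blast
  from this[OF x] have "f x = 0" using True order_bounded_null[OF order_bounded_dual[OF M f] x _ M] by auto
  then show ?thesis using d c by simp
next
  case False
  then have N: "0 < luxemburg_norm M \<Phi> x" using luxemburg_norm_nonneg[OF M x] by simp
  have "modular M \<Phi> (\<lambda>t. (1 / c) * x t) \<le> ennreal (1 / c) * modular M \<Phi> x"
    by (rule modular_scale[OF M mo_space_measurable[OF x]]) (use c in auto)
  also have "\<dots> \<le> ennreal (1 / c) * ennreal c" by (intro mult_left_mono mx) simp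
  also have "\<dots> = 1" using c by (simp add: ennreal_mult[symmetric])
  finally have Nc: "luxemburg_norm M \<Phi> x \<le> c" using c by (intro luxemburg_norm_le) auto
  have "ennreal (\<bar>f x\<bar> / luxemburg_norm M \<Phi> x) \<le> dual_norm M \<Phi> f"
    unfolding dual_norm_def by (rule SUP_upper) (use x False in auto)
  also note d(1)
  finally have "\<bar>f x\<bar> / luxemburg_norm M \<Phi> x \<le> d" using d by simp
  then have "\<bar>f x\<bar> \<le> d * luxemburg_norm M \<Phi> x" using N by (simp add: field_simps)
  also have "\<dots> \<le> d * c" using Nc d by (intro mult_left_mono)
  finally show ?thesis by simp
qed

section \<open>Gluing two functions along decreasing sets\<close>

lemma modular_gluing:
  assumes M: "musielak_orlicz M \<Phi>" and u: "u \<in> borel_measurable M" and w: "w \<in> borel_measurable M"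
    and I: "modular M \<Phi> u \<le> 1" "modular M \<Phi> w < \<infinity>" and E: "vanishing_sets M E" and e: "0 < (e::real)"
  shows "eventually (\<lambda>n. modular M \<Phi> (\<lambda>t. u t * (1 - indicator (E n) t) + w t * indicator (E n) t) \<le> ennreal (1 + e))
    sequentially"
proof -
  obtain h where [measurable]: "h \<in> borel_measurable M" and h: "AE t in M. \<Phi> t (ennreal \<bar>u t\<bar>) = h t"
    using modular_integrand_measurable[OF M u] by auto
  obtain k where [measurable]: "k \<in> borel_measurable M" and k: "AE t in M. \<Phi> t (ennreal \<bar>w t\<bar>) = k t"
    using modular_integrand_measurable[OF M w] by auto
  have [measurable]: "\<And>n. E n \<in> sets M" using E by (simp add: vanishing_sets_def)
  have hk: "(\<integral>\<^sup>+t. h t \<partial>M) \<le> 1" "(\<integral>\<^sup>+t. k t \<partial>M) < \<infinity>"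
    using I h k by (simp_all add: modular_def cong: nn_integral_cong_AE)
  \<comment> \<open>The finite modular of \<open>w\<close> makes \<open>k\<close> an integrable
    majorant.\<close>
  have "(\<lambda>n. \<integral>\<^sup>+t. k t * indicator (E n) t \<partial>M) \<longlonglongrightarrow> (\<integral>\<^sup>+t. 0 \<partial>M)"
  proof (rule nn_integral_dominated_convergence[where w = k])
    show "AE t in M. k t * indicator (E n) t \<le> k t" for n by (auto simp: indicator_def)
    show "AE t in M. (\<lambda>n. k t * indicator (E n) t) \<longlonglongrightarrow> 0"
      using vanishing_sets_tendsto[OF E]
    proof eventually_elim
      case (elim t)
      show ?case by (rule tendsto_eventually) (use elim in eventually_elim, simp)
    qed
  qed (use hk in auto)
  then have "eventually (\<lambda>n. (\<integral>\<^sup>+t. k t * indicator (E n) t \<partial>M) < ennreal e) sequentially"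
    using e by (intro order_tendstoD) auto
  then show ?thesis
  proof eventually_elim
    case (elim n)
    have "modular M \<Phi> (\<lambda>t. u t * (1 - indicator (E n) t) + w t * indicator (E n) t) \<le>
        (\<integral>\<^sup>+t. h t + k t * indicator (E n) t \<partial>M)"
      unfolding modular_def
      by (rule nn_integral_mono_AE, use h k in eventually_elim) (auto simp: indicator_def)
    also have "\<dots> = (\<integral>\<^sup>+t. h t \<partial>M) + (\<integral>\<^sup>+t. k t * indicator (E n) t \<partial>M)"
      by (rule nn_integral_add) auto
    also have "\<dots> \<le> 1 + ennreal e" using hk elim by (intro add_mono) auto
    also have "\<dots> = ennreal (1 + e)" using e by simp
    finally show ?case .
  qed
qed

text \<open>The test function \<open>a u\<close> off \<open>E\<^sub>n\<close> and \<open>b w\<close> on \<open>E\<^sub>n\<close>, where \<open>E\<^sub>n\<close> carries the singular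
  component, has modular at most \<open>1 + o(1)\<close>.\<close>

lemma components_le:
  assumes M: "musielak_orlicz M \<Phi>" and f: "f \<in> mo_dual M \<Phi>"
    and d: "dual_norm M \<Phi> f \<le> ennreal d" "0 \<le> d"
    and u: "u \<in> mo_space M \<Phi>" "modular M \<Phi> (\<lambda>t. a * u t) \<le> 1"
    and w: "w \<in> mo_space M \<Phi>" "modular M \<Phi> (\<lambda>t. b * w t) \<le> 1"
  shows "a * order_continuous_component M \<Phi> f u + b * singular_component M \<Phi> f w \<le> d"
proof (rule field_le_epsilon)
  let ?c = "order_continuous_component M \<Phi> f" and ?s = "singular_component M \<Phi> f"
  let ?r = "cone_abs M \<Phi> f"
  fix e :: real assume e: "0 < e"
  \<comment> \<open>The excess \<delta> of the modular costs d \<delta>, and the four error terms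
    below cost |a| \<delta> twice and |b| \<delta> twice. The summand 1 keeps the denominator
    positive.\<close>
  define \<delta> where "\<delta> = e / (1 + d + 2 * \<bar>a\<bar> + 2 * \<bar>b\<bar>)"
  have \<delta>: "0 < \<delta>" "\<delta> * (d + 2 * \<bar>a\<bar> + 2 * \<bar>b\<bar>) \<le> e"
  proof -
    have pos: "0 < 1 + d + 2 * \<bar>a\<bar> + 2 * \<bar>b\<bar>" using d by (simp add: add_pos_nonneg)
    then show "0 < \<delta>" using e by (simp add: \<delta>_def)
    then have "\<delta> * (d + 2 * \<bar>a\<bar> + 2 * \<bar>b\<bar>) \<le> \<delta> * (1 + d + 2 * \<bar>a\<bar> + 2 * \<bar>b\<bar>)"
      by (intro mult_left_mono) auto
    also have "\<dots> = e" using pos by (simp add: \<delta>_def)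
    finally show "\<delta> * (d + 2 * \<bar>a\<bar> + 2 * \<bar>b\<bar>) \<le> e" .
  qed
  note r = cone_additive_cone_abs[OF M f]
  note sm = cone_additive_mono[OF M cone_additive_singular[OF M r]]
  note cm = cone_additive_mono[OF M cone_additive_cone_inf[OF M r]]
  \<comment> \<open>A common majorant of |u| and |w|, so that the same sets E_n work for both
    functions.\<close>
  define v where "v t = \<bar>u t\<bar> + \<bar>w t\<bar>" for t
  have v: "v \<in> pos_cone M \<Phi>"
    unfolding v_def by (intro pos_cone_add[OF M] pos_cone_parts(3)[OF M] u w)
  obtain E where E: "vanishing_sets M E"
    and sE: "\<And>n. ?r (\<lambda>t. v t * (1 - indicator (E n) t)) -
      cone_inf M \<Phi> ?r (\<lambda>t. v t * (1 - indicator (E n) t)) \<le> \<delta>"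
    using singular_concentrated[OF M r v \<delta>(1)] by blast
  have Em: "E n \<in> sets M" for n using E by (simp add: vanishing_sets_def)
  have s_small: "\<bar>?s (\<lambda>t. y t * (1 - indicator (E n) t))\<bar> \<le> \<delta>"
    if y: "y \<in> mo_space M \<Phi>" "\<And>t. \<bar>y t\<bar> \<le> v t" for y n
  proof -
    note yE = restrict_mo_space(2)[OF M y(1) Em[of n]]
    have "AE t in M. \<bar>y t * (1 - indicator (E n) t)\<bar> \<le> v t * (1 - indicator (E n) t)"
      using y(2) by (auto simp: indicator_def)
    from cone_mono_le[OF sm pos_cone_parts(3)[OF M yE] restrict_pos_cone(2)[OF M v Em] this]
    show ?thesis using singular_component_bound[OF M f yE] sE[of n] by linarith
  qed
  have c_small: "\<bar>?c (\<lambda>t. y t * indicator (E n) t)\<bar> \<le> \<delta>"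
    if y: "y \<in> mo_space M \<Phi>" "\<And>t. \<bar>y t\<bar> \<le> v t"
      and n: "cone_inf M \<Phi> ?r (\<lambda>t. v t * indicator (E n) t) < \<delta>" for y n
  proof -
    note yE = restrict_mo_space(1)[OF M y(1) Em[of n]]
    have "AE t in M. \<bar>y t * indicator (E n) t\<bar> \<le> v t * indicator (E n) t"
      using y(2) by (auto simp: indicator_def)
    from cone_mono_le[OF cm pos_cone_parts(3)[OF M yE] restrict_pos_cone(1)[OF M v Em] this]
    show ?thesis using order_continuous_component_bound[OF M f yE] n by linarith
  qed
  have uv: "\<bar>u t\<bar> \<le> v t" "\<bar>w t\<bar> \<le> v t" for t by (auto simp: v_def)
  define x where "x n t = (a * u t) * (1 - indicator (E n) t) + (b * w t) * indicator (E n) t" for n t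
  have "eventually (\<lambda>n. modular M \<Phi> (x n) \<le> ennreal (1 + \<delta>)) sequentially"
    unfolding x_def
    by (rule modular_gluing[OF M _ _ u(2) _ E \<delta>(1)])
      (use mo_space_measurable[OF u(1)] mo_space_measurable[OF w(1)] w(2) in \<open>auto intro: le_less_trans\<close>)
  moreover have "eventually (\<lambda>n. cone_inf M \<Phi> ?r (\<lambda>t. v t * indicator (E n) t) < \<delta>) sequentially"
    by (rule order_tendstoD(2)[OF cone_inf_vanishing[OF M r v E] \<delta>(1)])
  ultimately have "eventually (\<lambda>n. modular M \<Phi> (x n) \<le> ennreal (1 + \<delta>) \<and>
    cone_inf M \<Phi> ?r (\<lambda>t. v t * indicator (E n) t) < \<delta>) sequentially" by (rule eventually_conj)
  then obtain n where n: "modular M \<Phi> (x n) \<le> ennreal (1 + \<delta>)"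
    "cone_inf M \<Phi> ?r (\<lambda>t. v t * indicator (E n) t) < \<delta>"
    using eventually_happens'[OF sequentially_bot] by blast
  define u1 where "u1 t = u t * (1 - indicator (E n) t)" for t
  define u2 where "u2 t = u t * indicator (E n) t" for t
  define w1 where "w1 t = w t * (1 - indicator (E n) t)" for t
  define w2 where "w2 t = w t * indicator (E n) t" for t
  have sp: "u1 \<in> mo_space M \<Phi>" "w1 \<in> mo_space M \<Phi>" "w2 \<in> mo_space M \<Phi>"
    unfolding u1_def w1_def w2_def
    by (intro restrict_mo_space[OF M _ Em] u(1) w(1))+
  \<comment> \<open>The scalars are taken out through linearity of \<open>f\<close> and stay outside
    both components, so the argument calls on homogeneity of \<open>f\<close> alone.\<close>
  have xeq: "x n = (\<lambda>t. a * u1 t + b * w2 t)"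
    by (auto simp: x_def u1_def w2_def)
  have "x n \<in> mo_space M \<Phi>" unfolding xeq by (rule mo_space_lincomb[OF M sp(1,3)])
  then have "f (x n) \<le> d * (1 + \<delta>)"
    using dual_norm_upper[OF M f d _ _ n(1)] \<delta>(1) by simp
  moreover have "f (x n) = a * f u1 + b * f w2"
    unfolding xeq by (rule mo_dual_lincomb[OF f sp(1,3)])
  \<comment> \<open>Both values come from f = f_c + f_s, with f_c u1 = f_c u - f_c u2 here and f_s
    w2 = f_s w - f_s w1 below. All terms other than f_c u and f_s w are errors of size at most
    \<delta>.\<close>
  moreover have "f u1 = ?c u - ?c u2 + ?s u1"
    using order_continuous_component_restrict[OF M f u(1) Em[of n]]
    by (simp add: singular_component_def u1_def[abs_def] u2_def[abs_def])
  moreover have "f w2 = ?s w - ?s w1 + ?c w2"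
  proof -
    have "w = (\<lambda>t. 1 * w1 t + 1 * w2 t)" by (simp add: w1_def w2_def algebra_simps)
    then have "f w = f w1 + f w2" using mo_dual_lincomb[OF f sp(2,3), of 1 1] by simp
    moreover have "?c w = ?c w2 + ?c w1"
      unfolding w1_def[abs_def] w2_def[abs_def]
      by (rule order_continuous_component_restrict[OF M f w(1) Em[of n]])
    ultimately show ?thesis by (simp add: singular_component_def)
  qed
  ultimately have "a * ?c u + b * ?s w \<le>
      d * (1 + \<delta>) + a * ?c u2 - a * ?s u1 + b * ?s w1 - b * ?c w2"
    by (simp add: algebra_simps)
  also have "\<dots> \<le> d * (1 + \<delta>) + \<bar>a\<bar> * \<delta> + \<bar>a\<bar> * \<delta> + \<bar>b\<bar> * \<delta> + \<bar>b\<bar> * \<delta>"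
  proof -
    have ab: "k * y \<le> \<bar>k\<bar> * \<delta>" "- (k * y) \<le> \<bar>k\<bar> * \<delta>" if "\<bar>y\<bar> \<le> \<delta>" for k y
      using mult_left_mono[OF that, of "\<bar>k\<bar>"] abs_le_D1[of "k * y"] abs_le_D2[of "k * y"]
      by (auto simp: abs_mult)
    have "\<bar>?c u2\<bar> \<le> \<delta>" "\<bar>?c w2\<bar> \<le> \<delta>"
      unfolding u2_def[abs_def] w2_def[abs_def]
      by (rule c_small[OF u(1) uv(1) n(2)], rule c_small[OF w(1) uv(2) n(2)])
    moreover have "\<bar>?s u1\<bar> \<le> \<delta>" "\<bar>?s w1\<bar> \<le> \<delta>"
      unfolding u1_def[abs_def] w1_def[abs_def]
      by (rule s_small[OF u(1) uv(1)], rule s_small[OF w(1) uv(2)])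
    ultimately have "a * ?c u2 \<le> \<bar>a\<bar> * \<delta>" "- (a * ?s u1) \<le> \<bar>a\<bar> * \<delta>"
      "b * ?s w1 \<le> \<bar>b\<bar> * \<delta>" "- (b * ?c w2) \<le> \<bar>b\<bar> * \<delta>"
      using ab by blast+
    then show ?thesis by linarith
  qed
  also have "\<dots> = d + \<delta> * (d + 2 * \<bar>a\<bar> + 2 * \<bar>b\<bar>)" by (simp add: algebra_simps)
  also have "\<dots> \<le> d + e" using \<delta>(2) by simp
  finally show "a * ?c u + b * ?s w \<le> d + e" .
qed

text \<open>Here division by a vanishing norm gives \<open>0\<close>, which does no harm.\<close>

lemma components_quotient_le:
  assumes M: "musielak_orlicz M \<Phi>" and f: "f \<in> mo_dual M \<Phi>"
    and d: "dual_norm M \<Phi> f \<le> ennreal d" "0 \<le> d"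
    and u: "u \<in> mo_space M \<Phi>" and w: "w \<in> mo_space M \<Phi>"
  shows "\<bar>order_continuous_component M \<Phi> f u\<bar> / luxemburg_norm M \<Phi> u +
    \<bar>singular_component M \<Phi> f w\<bar> / luxemburg_norm M \<Phi> w \<le> d"
proof -
  let ?c = "order_continuous_component M \<Phi> f u" and ?s = "singular_component M \<Phi> f w"
  \<comment> \<open>Dividing by N + e instead of N keeps the modular at most 1 whether or not the
    infimum in the norm is attained. The value 0 at N = 0 agrees with the convention 1 / 0 = 0, so
    that 1 / N is the limit as e decreases to 0 in all cases.\<close>
  define g where "g N (e::real) = (if N = 0 then 0 else 1 / (N + e))" for N e :: real
  have g: "modular M \<Phi> (\<lambda>t. sgn k * g (luxemburg_norm M \<Phi> y) e * y t) \<le> 1"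
    if "y \<in> mo_space M \<Phi>" "0 < e" for y e and k :: real
  proof -
    define N where "N = luxemburg_norm M \<Phi> y"
    have N: "0 \<le> N" unfolding N_def by (rule luxemburg_norm_nonneg[OF M that(1)])
    have "modular M \<Phi> (\<lambda>t. sgn k * g N e * y t) \<le> modular M \<Phi> (\<lambda>t. y t / (N + e))"
      by (rule modular_mono[OF M])
        (use N that(2) in \<open>auto simp: g_def abs_mult sgn_if\<close>)
    also have "\<dots> \<le> 1"
      using modular_le_1_of_luxemburg_norm_less[OF M that(1), of "N + e"] that(2) by (simp add: N_def)
    finally show ?thesis by (simp add: N_def)
  qed
  have lim: "((\<lambda>e. g N e) \<longlongrightarrow> 1 / N) (at_right 0)" for N
  proof (cases "N = 0")
    case False
    then have "((\<lambda>e. 1 / (N + e)) \<longlongrightarrow> 1 / (N + 0)) (at_right 0)" by (intro tendsto_intros) auto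
    with False show ?thesis by (simp add: g_def)
  qed (simp add: g_def)
  have "((\<lambda>e. g (luxemburg_norm M \<Phi> u) e * \<bar>?c\<bar> + g (luxemburg_norm M \<Phi> w) e * \<bar>?s\<bar>) \<longlongrightarrow>
      1 / luxemburg_norm M \<Phi> u * \<bar>?c\<bar> + 1 / luxemburg_norm M \<Phi> w * \<bar>?s\<bar>) (at_right 0)"
    by (intro tendsto_intros lim)
  moreover have "eventually (\<lambda>e. g (luxemburg_norm M \<Phi> u) e * \<bar>?c\<bar> + g (luxemburg_norm M \<Phi> w) e * \<bar>?s\<bar> \<le> d) (at_right 0)"
    using eventually_at_right_less[of "0::real"]
  proof eventually_elim
    case (elim e)
    \<comment> \<open>The scalars a and b of \<open>components_le\<close> are chosen with the signs
      of the two component values, which produces the absolute values.\<close>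
    have k: "x * \<bar>k\<bar> = sgn k * x * k" for x k :: real by (simp add: abs_sgn)
    show ?case unfolding k
      by (rule components_le[OF M f d u g[OF u elim] w g[OF w elim]])
  qed
  ultimately have "1 / luxemburg_norm M \<Phi> u * \<bar>?c\<bar> + 1 / luxemburg_norm M \<Phi> w * \<bar>?s\<bar> \<le> d"
    by (rule tendsto_upperbound) simp
  then show ?thesis by simp
qed

theorem proposition7:
  fixes M :: "'a measure" and \<Phi> :: "'a \<Rightarrow> ennreal \<Rightarrow> ennreal"
    and f :: "('a \<Rightarrow> real) \<Rightarrow> real"
  assumes "sigma_finite_measure M"
    and "nonatomic M"
    and "musielak_orlicz M \<Phi>"
    and "f \<in> mo_dual M \<Phi>"
  shows "dual_norm M \<Phi> f =
    dual_norm M \<Phi> (order_continuous_component M \<Phi> f) +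
    dual_norm M \<Phi> (singular_component M \<Phi> f)"
proof (rule antisym)
  let ?c = "order_continuous_component M \<Phi> f" and ?s = "singular_component M \<Phi> f"
  let ?U = "{u \<in> mo_space M \<Phi>. \<not> (AE t in M. u t = 0)}"
  let ?N = "luxemburg_norm M \<Phi>"
  note M = assms(3)
  have N: "0 \<le> ?N u" if "u \<in> ?U" for u using luxemburg_norm_nonneg[OF M] that by simp
  show "dual_norm M \<Phi> f \<le> dual_norm M \<Phi> ?c + dual_norm M \<Phi> ?s"
    unfolding dual_norm_def[of M \<Phi> f]
  proof (rule SUP_least)
    fix u assume u: "u \<in> ?U"
    have "\<bar>f u\<bar> / ?N u \<le> \<bar>?c u\<bar> / ?N u + \<bar>?s u\<bar> / ?N u"
      using N[OF u] by (simp add: singular_component_def add_divide_distrib[symmetric] divide_right_mono)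
    then have "ennreal (\<bar>f u\<bar> / ?N u) \<le> ennreal (\<bar>?c u\<bar> / ?N u) + ennreal (\<bar>?s u\<bar> / ?N u)"
      using N[OF u] by (simp add: ennreal_plus[symmetric] ennreal_leI del: ennreal_plus)
    also have "\<dots> \<le> dual_norm M \<Phi> ?c + dual_norm M \<Phi> ?s"
      unfolding dual_norm_def by (intro add_mono SUP_upper u)
    finally show "ennreal (\<bar>f u\<bar> / ?N u) \<le> dual_norm M \<Phi> ?c + dual_norm M \<Phi> ?s" .
  qed
  show "dual_norm M \<Phi> ?c + dual_norm M \<Phi> ?s \<le> dual_norm M \<Phi> f"
  \<comment> \<open>In the trivial space all suprema are over the empty set and equal 0; the case is
    separated because a constant can be moved into a supremum only over a nonempty set. An infinite
    norm makes the inequality trivial, so \<open>d\<close> may be taken real.\<close>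
  proof (cases "?U = {} \<or> dual_norm M \<Phi> f = \<infinity>")
    case True
    then show ?thesis
    proof
      assume U: "?U = {}"
      show ?thesis unfolding dual_norm_def U by (simp add: bot_ennreal)
    qed simp
  next
    case False
    then obtain d where d: "dual_norm M \<Phi> f = ennreal d" "0 \<le> d"
      by (cases "dual_norm M \<Phi> f") auto
    \<comment> \<open>The functions u and w vary independently, so the suprema over them can be
      taken one after the other.\<close>
    have le: "ennreal (\<bar>?c u\<bar> / ?N u) + ennreal (\<bar>?s w\<bar> / ?N w) \<le> dual_norm M \<Phi> f"
      if u: "u \<in> ?U" and w: "w \<in> ?U" for u w
      using components_quotient_le[OF M assms(4) _ d(2), of u w] u w N[OF u] N[OF w] d
      by (simp add: ennreal_plus[symmetric] ennreal_leI del: ennreal_plus)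
    have "dual_norm M \<Phi> ?c + dual_norm M \<Phi> ?s =
        (SUP u\<in>?U. ennreal (\<bar>?c u\<bar> / ?N u) + dual_norm M \<Phi> ?s)"
      unfolding dual_norm_def[of M \<Phi> ?c] using False by (intro ennreal_SUP_add_left[symmetric]) auto
    also have "\<dots> \<le> dual_norm M \<Phi> f"
    proof (rule SUP_least)
      fix u assume u: "u \<in> ?U"
      have "ennreal (\<bar>?c u\<bar> / ?N u) + dual_norm M \<Phi> ?s =
          (SUP w\<in>?U. ennreal (\<bar>?c u\<bar> / ?N u) + ennreal (\<bar>?s w\<bar> / ?N w))"
        unfolding dual_norm_def using False by (intro ennreal_SUP_add_right) auto
      also have "\<dots> \<le> dual_norm M \<Phi> f" by (intro SUP_least le u)
      finally show "ennreal (\<bar>?c u\<bar> / ?N u) + dual_norm M \<Phi> ?s \<le> dual_norm M \<Phi> f" .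
    qed
    finally show ?thesis .
  qed
qed

end
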